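(* Let $k\ge 2$ be an integer and let $G$ be a $k$-degenerated graph with at least one edge and without isolated edges. Then $$\chi_{1-vsdt}(G)\le \min\{k\Delta(G)+3,\ 4\Delta(G)\},$$ where $\Delta(G)$ is the maximum degree of $G$.
   Context: All graphs are finite, simple and undirected. A graph $G$ is $k$-degenerated if $\delta(H)\le k$ for every subgraph $H$ of $G$, where $\delta(H)$ is the minimum degree. For a vertex $u$ of $G$, let $N\langle u\rangle = N[u]\cup\{uv : v\in N(u)\}$, where $N(u)$ and $N[u]=N(u)\cup\{u\}$ are the open and closed neighborhoods; so $N\langle u\rangle$ consists of $u$, its neighbors and its incident edges. A proper $\kappa$-total coloring of $G$ is a map $f:V(G)\cup E(G)\to\{1,\dots,\kappa\}$ such that any two adjacent vertices, any two edges sharing an endpoint, and any vertex and incident edge receive different colors. Put $C_f\langle u\rangle=\{f(x): x\in N\langle u\rangle\}$. For a graph $G$ with no isolated edges (no connected component is $K_2$), a $\kappa$-$D(1)$-VSDTC of $G$ ($1$-vertex-strongly-distinguishing total coloring) is a proper $\kappa$-total coloring $f$ such that $C_f\langle u\rangle\neq C_f\langle v\rangle$ for any two adjacent vertices $u,v$. $\chi_{1-vsdt}(G)$ is the minimum $\kappa$ for which $G$ admits a $\kappa$-$D(1)$-VSDTC. *)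

theory Defs
  imports Main "HOL-Library.FuncSet" "HOL-Library.Extended_Nat"
begin

type_synonym 'a graph = "'a set \<times> 'a set set"

abbreviation verts :: "'a graph \<Rightarrow> 'a set" where "verts G \<equiv> fst G"
abbreviation edges :: "'a graph \<Rightarrow> 'a set set" where "edges G \<equiv> snd G"

definition finite_simple_graph :: "'a graph \<Rightarrow> bool" where
  "finite_simple_graph G \<longleftrightarrow>
     finite (verts G) \<and> (\<forall>e\<in>edges G. e \<subseteq> verts G \<and> card e = 2)"

definition subgraph :: "'a graph \<Rightarrow> 'a graph \<Rightarrow> bool" where
  "subgraph H G \<longleftrightarrow>
     finite_simple_graph H \<and> verts H \<subseteq> verts G \<and> edges H \<subseteq> edges G"

definition nbhd :: "'a graph \<Rightarrow> 'a \<Rightarrow> 'a set" where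
  "nbhd G u = {v. {u, v} \<in> edges G}"

definition closed_nbhd :: "'a graph \<Rightarrow> 'a \<Rightarrow> 'a set" where
  "closed_nbhd G u = insert u (nbhd G u)"

definition degree :: "'a graph \<Rightarrow> 'a \<Rightarrow> nat" where
  "degree G u = card (nbhd G u)"

text \<open>The minimum and maximum degree are only meaningful for graphs with at least one vertex.\<close>

definition min_degree :: "'a graph \<Rightarrow> nat" where
  "min_degree G = Min (degree G ` verts G)"

definition max_degree :: "'a graph \<Rightarrow> nat" where
  "max_degree G = Max (degree G ` verts G)"

definition degenerated :: "nat \<Rightarrow> 'a graph \<Rightarrow> bool" where
  "degenerated k G \<longleftrightarrow> (\<forall>H. subgraph H G \<and> verts H \<noteq> {} \<longrightarrow> min_degree H \<le> k)"

definition adj_rel :: "'a graph \<Rightarrow> ('a \<times> 'a) set" where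
  "adj_rel G = {(u, v). {u, v} \<in> edges G}"

text \<open>A connected component is represented by its vertex set.\<close>

definition components :: "'a graph \<Rightarrow> 'a set set" where
  "components G = {{v. (u, v) \<in> (adj_rel G)\<^sup>*} | u. u \<in> verts G}"

text \<open>An edge is isolated if its two endpoints form a connected component, i.e. a component
  isomorphic to the complete graph on two vertices.\<close>

definition isolated_edge :: "'a graph \<Rightarrow> 'a set \<Rightarrow> bool" where
  "isolated_edge G e \<longleftrightarrow> e \<in> edges G \<and> e \<in> components G"

text \<open>The disjoint union of vertices and edges is modelled by the sum type: \<open>Inl v\<close> is the
  vertex \<open>v\<close> and \<open>Inr e\<close> is the edge \<open>e\<close>. The following is the set written
  \<open>N\<langle>u\<rangle>\<close>: the vertex \<open>u\<close>, its neighbours and its incident edges.\<close>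

definition total_nbhd :: "'a graph \<Rightarrow> 'a \<Rightarrow> ('a + 'a set) set" where
  "total_nbhd G u = closed_nbhd G u <+> {{u, v} | v. v \<in> nbhd G u}"

definition proper_total_coloring :: "'a graph \<Rightarrow> nat \<Rightarrow> ('a + 'a set \<Rightarrow> nat) \<Rightarrow> bool" where
  "proper_total_coloring G \<kappa> f \<longleftrightarrow>
     f \<in> (verts G <+> edges G) \<rightarrow> {1..\<kappa>} \<and>
     (\<forall>u v. {u, v} \<in> edges G \<longrightarrow> f (Inl u) \<noteq> f (Inl v)) \<and>
     (\<forall>e\<in>edges G. \<forall>e'\<in>edges G. e \<noteq> e' \<and> e \<inter> e' \<noteq> {} \<longrightarrow> f (Inr e) \<noteq> f (Inr e')) \<and>
     (\<forall>e\<in>edges G. \<forall>v\<in>e. f (Inl v) \<noteq> f (Inr e))"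

definition color_set :: "'a graph \<Rightarrow> ('a + 'a set \<Rightarrow> nat) \<Rightarrow> 'a \<Rightarrow> nat set" where
  "color_set G f u = f ` total_nbhd G u"

definition D1_VSDTC :: "'a graph \<Rightarrow> nat \<Rightarrow> ('a + 'a set \<Rightarrow> nat) \<Rightarrow> bool" where
  "D1_VSDTC G \<kappa> f \<longleftrightarrow>
     proper_total_coloring G \<kappa> f \<and>
     (\<forall>u v. {u, v} \<in> edges G \<longrightarrow> color_set G f u \<noteq> color_set G f v)"

text \<open>The minimum number of colors. It is taken in the extended naturals, so that the value would
  be \<open>\<infinity>\<close>, rather than an arbitrary number, if no such coloring existed.\<close>

definition chi_1vsdt :: "'a graph \<Rightarrow> enat" where
  "chi_1vsdt G = Inf {enat \<kappa> | \<kappa>. \<exists>f. D1_VSDTC G \<kappa> f}"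

end

theory Submission
  imports Defs Complex_Main
begin

text \<open>
  Let \<open>D\<close> be the maximum degree; \<open>D \<ge> 2\<close> since no edge is isolated. Colour the vertices greedily
  with a palette of \<open>min k D + 1\<close> colours and the edges with a disjoint palette; it then suffices that
  adjacent vertices of equal degree see different sets of edge colours. With \<open>3D - 1\<close> edge colours
  this is possible: add the vertices one at a time and colour the star at the new vertex so that
  the star does not receive the same colour set as one of its leaves. This gives \<open>4D\<close>, and \<open>3D + 3\<close> for
  \<open>k = 3\<close>; for \<open>k \<ge> 4\<close> the bound \<open>4D\<close> is the smaller one. For \<open>k = 2\<close> and \<open>D \<ge> 3\<close>, \<open>2D\<close> edge colours are
  enough: remove a vertex of degree at most 2 having a neighbour of degree at least 3 which itself
  has at most two neighbours of degree at least 3. For \<open>k = D = 2\<close> four edge colours do not suffice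
  on the 5-cycle, so some edges borrow a vertex colour; adjacent vertices are still distinguished
  by the edge palette alone.
\<close>

section \<open>Choosing the colours of a star\<close>

text \<open>
  The constraint of \<open>i\<close> is alive as long as the colours chosen so far, other than that of \<open>i\<close>, all lie
  in \<open>A i\<close>. Its weight bounds the probability that it is violated when every remaining colour
  is drawn uniformly from a list of the size guaranteed by \<open>step\<close>. The total weight does not
  increase on average, so a total below 1 can be maintained until the end.
\<close>

lemma weighted_extension:
  fixes X :: "'a set" and A :: "'a \<Rightarrow> 'c set" and OK :: "'a set \<Rightarrow> ('a \<Rightarrow> 'c) \<Rightarrow> bool"
  assumes X: "finite X" and T: "T \<subseteq> X"
    and A: "\<And>i. i \<in> T \<Longrightarrow> finite (A i) \<and> card (A i) = card X - 1"
    and inj: "\<And>Z h. OK Z h \<Longrightarrow> inj_on h Z"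
    and step: "\<And>Z h x. OK Z h \<Longrightarrow> Z \<subseteq> X \<Longrightarrow> x \<in> X - Z \<Longrightarrow>
      \<exists>L. card L = card (X - Z) + 1 \<and> L \<inter> h ` Z = {} \<and> (\<forall>c\<in>L. OK (insert x Z) (h(x := c)))"
  defines "wt \<equiv> \<lambda>Z h i. if h ` (Z - {i}) \<subseteq> A i
      then 1 / (real (card (X - Z)) + (if i \<in> Z then 1 else 0)) else 0"
  assumes "OK Z h" "Z \<subseteq> X" "(\<Sum>i\<in>T. wt Z h i) < 1"
  shows "\<exists>h. OK X h \<and> (\<forall>i\<in>T. h ` (X - {i}) \<noteq> A i)"
  using assms(7-)
proof (induction "card (X - Z)" arbitrary: Z h)
  case 0
  have fT: "finite T" using T X finite_subset by blast
  have "Z = X" using 0 X by auto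
  \<comment> \<open>Once all of \<open>X\<close> is coloured, a live constraint weighs exactly 1,
    which a total below 1 rules out.\<close>
  moreover have "wt X h i = 0" if "i \<in> T" for i
  proof (rule ccontr)
    assume "wt X h i \<noteq> 0"
    then have "wt X h i = 1" using that T by (auto simp: wt_def split: if_splits)
    moreover have "wt X h i \<le> (\<Sum>i\<in>T. wt X h i)"
      using fT that by (intro member_le_sum) (auto simp: wt_def)
    ultimately show False using 0 \<open>Z = X\<close> by simp
  qed
  ultimately show ?case using 0(2) T by (intro exI[of _ h]) (fastforce simp: wt_def)
next
  case (Suc m)
  have fT: "finite T" using T X finite_subset by blast
  have fZ: "finite Z" using Suc X finite_subset by blast
  have cX: "card X = card Z + Suc m"
    using Suc X fZ by (metis card_Diff_subset card_mono le_add_diff_inverse)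
  obtain x where x: "x \<in> X - Z" using Suc by (metis card.empty equals0I nat.distinct(1))
  from step[OF Suc.prems(1,2) x] obtain L where L: "card L = Suc (Suc m)" "L \<inter> h ` Z = {}"
    "\<And>c. c \<in> L \<Longrightarrow> OK (insert x Z) (h(x := c))" using Suc(2) by auto
  have fL: "finite L" "L \<noteq> {}" using L(1) card.infinite by fastforce+
  have cZ: "card (X - insert x Z) = m"
    using Suc(2) x X by (metis DiffD1 DiffD2 Diff_insert2 Suc_inject card_Suc_Diff1 finite_Diff insert_Diff Diff_insert x)
  have hZ: "card (h ` Z) = card Z" using inj[OF Suc.prems(1)] by (rule card_image)
  have main: "(\<Sum>c\<in>L. wt (insert x Z) (h(x := c)) i) \<le> (real m + 2) * wt Z h i" if i: "i \<in> T" for i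
  proof (cases "h ` (Z - {i}) \<subseteq> A i")
    case False
    have "\<not> (h(x:=c)) ` (insert x Z - {i}) \<subseteq> A i" for c
    proof -
      have "h ` (Z - {i}) \<subseteq> (h(x:=c)) ` (insert x Z - {i})" using x by fastforce
      then show ?thesis using False by blast
    qed
    then have "wt (insert x Z) (h(x := c)) i = 0" for c
      unfolding wt_def by (simp only: if_False)
    then show ?thesis using False by (simp add: wt_def)
  next
    case al: True
    have fA: "finite (A i)" "card (A i) = card Z + m" using A[OF i] cX by auto
    consider "i \<in> Z" | "i = x" | "i \<in> X - Z" "i \<noteq> x" using i T by blast
    then show ?thesis
    proof cases
      case 1
      have sub: "h ` (Z - {i}) \<subseteq> A i" using al .
      have ch: "card (h ` (Z - {i})) = card Z - 1"
        using inj[OF Suc.prems(1)] 1 by (subst card_image) (auto intro: inj_on_subset)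
      have "card Z > 0" using 1 fZ card_gt_0_iff by blast
      then have cd: "card (A i - h ` (Z - {i})) = Suc m"
        using fA ch sub fZ by (subst card_Diff_subset) auto
      have "(\<Sum>c\<in>L. wt (insert x Z) (h(x := c)) i)
          \<le> (\<Sum>c\<in>L. if c \<in> A i - h ` (Z - {i}) then 1 / (real m + 1) else 0)"
      proof (rule sum_mono)
        fix c assume c: "c \<in> L"
        have "c \<in> A i - h ` (Z - {i})" if "(h(x:=c)) ` (insert x Z - {i}) \<subseteq> A i"
          using that L(2) c x 1 by fastforce
        then show "wt (insert x Z) (h(x := c)) i \<le> (if c \<in> A i - h ` (Z - {i}) then 1 / (real m + 1) else 0)"
          unfolding wt_def cZ using 1 by auto
      qed
      also have "\<dots> = real (card (L \<inter> (A i - h ` (Z - {i})))) / (real m + 1)"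
        by (subst sum.inter_restrict[symmetric]) (simp_all add: fL)
      also have "\<dots> \<le> real (Suc m) / (real m + 1)"
        using fA cd card_mono[of "A i - h ` (Z - {i})" "L \<inter> (A i - h ` (Z - {i}))"]
        by (intro divide_right_mono) auto
      also have "\<dots> = (real m + 2) * wt Z h i"
        unfolding wt_def Suc(2)[symmetric] using al 1 by (simp add: field_simps)
      finally show ?thesis .
    next
      \<comment> \<open>The colour of \<open>i\<close> itself is exempt, so every colour in
        \<open>L\<close> keeps the constraint alive and its weight stays at 1/(m+1).\<close>
      case 2
      have "(\<Sum>c\<in>L. wt (insert x Z) (h(x := c)) i) \<le> (\<Sum>c\<in>L. 1 / (real m + 1))"
        by (rule sum_mono) (auto simp: wt_def cZ 2)
      also have "\<dots> = (real m + 2) * wt Z h i"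
        unfolding wt_def Suc(2)[symmetric] using al 2 x L(1) by (simp add: field_simps)
      finally show ?thesis .
    next
      \<comment> \<open>At most \<open>m\<close> colours keep the constraint alive, each with new
        weight 1/m, so the sum is at most 1, below the allowance (m+2)/(m+1).\<close>
      case 3
      have zi: "Z - {i} = Z" using 3 by auto
      then have sub: "h ` Z \<subseteq> A i" using al by simp
      have cd: "card (A i - h ` Z) = m"
        using fA hZ sub fZ by (subst card_Diff_subset) auto
      have m: "m > 0" 
      proof -
        have "i \<in> X - insert x Z" using 3 by auto
        then show ?thesis using cZ X by (metis card_gt_0_iff empty_iff finite_Diff)
      qed
      have "(\<Sum>c\<in>L. wt (insert x Z) (h(x := c)) i)
          \<le> (\<Sum>c\<in>L. if c \<in> A i - h ` Z then 1 / real m else 0)"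
      proof (rule sum_mono)
        fix c assume c: "c \<in> L"
        have "c \<in> A i - h ` Z" if "(h(x:=c)) ` (insert x Z - {i}) \<subseteq> A i"
          using that L(2) c x 3 by fastforce
        then show "wt (insert x Z) (h(x := c)) i \<le> (if c \<in> A i - h ` Z then 1 / real m else 0)"
          unfolding wt_def cZ using 3 by auto
      qed
      also have "\<dots> = real (card (L \<inter> (A i - h ` Z))) / real m"
        by (subst sum.inter_restrict[symmetric]) (simp_all add: fL)
      also have "\<dots> \<le> real m / real m"
        using fA cd card_mono[of "A i - h ` Z" "L \<inter> (A i - h ` Z)"]
        by (intro divide_right_mono) auto
      also have "\<dots> \<le> (real m + 2) * wt Z h i"
        unfolding wt_def Suc(2)[symmetric] using al 3 m by (simp add: field_simps)
      finally show ?thesis .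
    qed
  qed
  have "(\<Sum>c\<in>L. \<Sum>i\<in>T. wt (insert x Z) (h(x := c)) i) = (\<Sum>i\<in>T. \<Sum>c\<in>L. wt (insert x Z) (h(x := c)) i)"
    by (rule sum.swap)
  also have "\<dots> \<le> (\<Sum>i\<in>T. (real m + 2) * wt Z h i)" by (intro sum_mono main)
  also have "\<dots> = (real m + 2) * (\<Sum>i\<in>T. wt Z h i)" by (simp add: sum_distrib_left)
  also have "\<dots> < (real m + 2) * 1" using Suc.prems(3) by (intro mult_strict_left_mono) auto
  also have "\<dots> = (\<Sum>c\<in>L. 1)" using L(1) by simp
  finally obtain c where c: "c \<in> L" "(\<Sum>i\<in>T. wt (insert x Z) (h(x := c)) i) < 1"
    by (meson linorder_not_less sum_mono)
  show ?case by (rule Suc(1)[OF _ L(3)[OF c(1)]]) (use cZ c Suc x in auto)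
qed

text \<open>
  With no colour chosen, the total weight can be exactly 1 (when \<open>T = X\<close>). Giving the first element a
  colour outside \<open>A x2\<close> for some other \<open>x2\<close> makes it smaller than 1.
\<close>

lemma star_extension:
  fixes X :: "'a set" and A :: "'a \<Rightarrow> 'c set" and OK :: "'a set \<Rightarrow> ('a \<Rightarrow> 'c) \<Rightarrow> bool"
  assumes X: "finite X" and T: "T \<subseteq> X" "card X = 1 \<Longrightarrow> T = {}"
    and A: "\<And>i. i \<in> T \<Longrightarrow> finite (A i) \<and> card (A i) = card X - 1"
    and inj: "\<And>Z h. OK Z h \<Longrightarrow> inj_on h Z"
    and step: "\<And>Z h x. OK Z h \<Longrightarrow> Z \<subseteq> X \<Longrightarrow> x \<in> X - Z \<Longrightarrow>
      \<exists>L. card L = card (X - Z) + 1 \<and> L \<inter> h ` Z = {} \<and> (\<forall>c\<in>L. OK (insert x Z) (h(x := c)))"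
    and start: "OK {} h0"
  shows "\<exists>h. OK X h \<and> (\<forall>i\<in>T. h ` (X - {i}) \<noteq> A i)"
proof -
  define wt :: "'a set \<Rightarrow> ('a \<Rightarrow> 'c) \<Rightarrow> 'a \<Rightarrow> real" where
    "wt = (\<lambda>Z h i. if h ` (Z - {i}) \<subseteq> A i
      then 1 / (real (card (X - Z)) + (if i \<in> Z then 1 else 0)) else 0)"
  have ext: "\<exists>h. OK X h \<and> (\<forall>i\<in>T. h ` (X - {i}) \<noteq> A i)"
    if "OK Z h" "Z \<subseteq> X" "(\<Sum>i\<in>T. wt Z h i) < 1" for Z h
    using weighted_extension[of X T A OK Z h] X T(1) A inj step that by (simp add: wt_def)
  show ?thesis
  proof (cases "T = X \<and> X \<noteq> {}")
    case False
    \<comment> \<open>With nothing coloured, every constraint is alive with weight 1 /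
      \<open>card X\<close>.\<close>
    have "card T < card X \<or> T = {}" using False T X by (metis psubsetI psubset_card_mono)
    then have "(\<Sum>i\<in>T. wt {} h0 i) < 1" by (auto simp: wt_def field_simps)
    then show ?thesis using ext start by blast
  next
    case True
    define n where "n = card X - 2"
    have "card X \<noteq> 0" "card X \<noteq> 1" using True T X by auto
    then have n: "card X = n + 2" by (simp add: n_def)
    obtain x1 where x1: "x1 \<in> X" using True by auto
    have "card (X - {x1}) \<noteq> 0" using n x1 by simp
    then obtain x2 where x2: "x2 \<in> X" "x2 \<noteq> x1" by (metis Diff_iff card.empty equals0I insertI1)
    obtain L where L: "card L = card X + 1" "\<And>c. c \<in> L \<Longrightarrow> OK {x1} (h0(x1 := c))"
      using step[OF start, of x1] x1 by auto
    \<comment> \<open>\<open>L\<close> has \<open>card X + 1\<close> colours, \<open>A x2\<close>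
      only \<open>card X - 1\<close>.\<close>
    have "\<not> L \<subseteq> A x2" using A[of x2] L(1) True x2 card_mono[of "A x2" L] by auto
    then obtain c where c: "c \<in> L" "c \<notin> A x2" by auto
    define h where "h = h0(x1 := c)"
    have cx: "card (X - {x1}) = n + 1" using n x1 X by simp
    \<comment> \<open>The constraint of \<open>x1\<close> weighs 1/(n+2), that of \<open>x2\<close>
      is dead, and each of the other \<open>n\<close> weighs at most 1/(n+1).\<close>
    have "(\<Sum>i\<in>T. wt {x1} h i) = wt {x1} h x1 + (wt {x1} h x2 + (\<Sum>i\<in>X - {x1} - {x2}. wt {x1} h i))"
      using True x1 x2 X by (simp add: sum.remove[of X x1] sum.remove[of "X - {x1}" x2])
    also have "wt {x1} h x2 = 0" using c x2 by (simp add: wt_def h_def)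
    also have "wt {x1} h x1 = 1 / (real n + 2)" by (simp add: wt_def cx)
    also have "(\<Sum>i\<in>X - {x1} - {x2}. wt {x1} h i) \<le> (\<Sum>i\<in>X - {x1} - {x2}. 1 / (real n + 1))"
      by (rule sum_mono) (auto simp: wt_def cx add.commute)
    also have "\<dots> = real n / (real n + 1)" using cx x2 X by simp
    also have "1 / (real n + 2) + (0 + real n / (real n + 1)) < 1"
    proof -
      have "1 / (real n + 2) < 1 / (real n + 1)" by (intro divide_strict_left_mono) auto
      moreover have "real n / (real n + 1) = 1 - 1 / (real n + 1)" by (simp add: field_simps)
      ultimately show ?thesis by linarith
    qed
    finally have "(\<Sum>i\<in>T. wt {x1} h i) < 1" by simp
    then show ?thesis using x1 L(2)[OF c(1)] by (intro ext[of "{x1}" h]) (auto simp: h_def)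
  qed
qed

text \<open>A set in \<open>\<F>\<close> rules out at most one colour: \<open>c\<close> is the only
  element of \<open>insert c S\<close> outside \<open>S\<close>.\<close>

lemma card_closing_colours:
  assumes "finite S" "finite \<F>"
  shows "finite {c. c \<notin> S \<and> insert c S \<in> \<F>}" "card {c. c \<notin> S \<and> insert c S \<in> \<F>} \<le> card \<F>"
proof -
  have i: "inj_on (\<lambda>c. insert c S) {c. c \<notin> S \<and> insert c S \<in> \<F>}" by (auto simp: inj_on_def)
  have s: "(\<lambda>c. insert c S) ` {c. c \<notin> S \<and> insert c S \<in> \<F>} \<subseteq> \<F>" by auto
  show "finite {c. c \<notin> S \<and> insert c S \<in> \<F>}" using inj_on_finite[OF i s assms(2)] .
  show "card {c. c \<notin> S \<and> insert c S \<in> \<F>} \<le> card \<F>" using card_inj_on_le[OF i s assms(2)] .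
qed

text \<open>In the applications \<open>S\<close> holds the colours already present at a vertex,
  \<open>\<F>\<close> the colour sets of neighbours that it must not acquire, and \<open>R\<close>
  further forbidden colours. Each family costs at most its cardinality.\<close>

lemma card_free_colours:
  assumes "finite S" "finite \<F>" "finite R" "finite B"
  shows "card B \<le> card {c \<in> B. c \<notin> S \<and> insert c S \<notin> \<F> \<and> c \<notin> R} + (card S + card \<F> + card R)"
proof -
  let ?K = "{c. c \<notin> S \<and> insert c S \<in> \<F>}" and ?G = "{c \<in> B. c \<notin> S \<and> insert c S \<notin> \<F> \<and> c \<notin> R}"
  have fin: "finite ?K" "card ?K \<le> card \<F>" using card_closing_colours assms by auto
  have "card B \<le> card (?G \<union> (S \<union> ?K \<union> R))" using assms fin by (intro card_mono) auto
  also have "\<dots> \<le> card ?G + card (S \<union> ?K \<union> R)" by (rule card_Un_le)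
  also have "card (S \<union> ?K \<union> R) \<le> card (S \<union> ?K) + card R" by (rule card_Un_le)
  also have "card (S \<union> ?K) \<le> card S + card ?K" by (rule card_Un_le)
  finally show ?thesis using fin by linarith
qed

lemma ex_free_colour:
  assumes "finite S" "finite \<F>" "finite R" "card S + card \<F> + card R < card B"
  shows "\<exists>c\<in>B. c \<notin> S \<and> insert c S \<notin> \<F> \<and> c \<notin> R"
proof (rule ccontr)
  assume "\<not> ?thesis"
  then have e: "{c \<in> B. c \<notin> S \<and> insert c S \<notin> \<F> \<and> c \<notin> R} = {}" by auto
  have "finite B" using assms(4) by (intro card_ge_0_finite) auto
  from card_free_colours[OF assms(1-3) this] show False using assms(4) unfolding e by simp
qed

section \<open>Distinguishing edge colourings of induced subgraphs\<close>

text \<open>\<open>N\<close> stays fixed and an induced subgraph is given by its vertex set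
  \<open>W\<close> alone, so an induction can delete a vertex without building a new graph.\<close>

locale adjacency =
  fixes N :: "'a \<Rightarrow> 'a set"
  assumes sym: "y \<in> N x \<Longrightarrow> x \<in> N y" and irrefl: "x \<notin> N x"
begin

definition deg :: "'a set \<Rightarrow> 'a \<Rightarrow> nat" where
  "deg W x = card (N x \<inter> W)"

definition cols :: "('a \<Rightarrow> 'a \<Rightarrow> nat) \<Rightarrow> 'a set \<Rightarrow> 'a \<Rightarrow> nat set" where
  "cols \<gamma> W x = \<gamma> x ` (N x \<inter> W)"

text \<open>Edge colours are functions of ordered pairs, so symmetry on the edges within
  \<open>W\<close> is made part of properness.\<close>

definition proper_edge :: "nat set \<Rightarrow> 'a set \<Rightarrow> ('a \<Rightarrow> 'a \<Rightarrow> nat) \<Rightarrow> bool" where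
  "proper_edge P W \<gamma> \<longleftrightarrow>
     (\<forall>x\<in>W. \<forall>y\<in>N x \<inter> W. \<gamma> x y = \<gamma> y x \<and> \<gamma> x y \<in> P) \<and> (\<forall>x\<in>W. inj_on (\<gamma> x) (N x \<inter> W))"

text \<open>
  The requirement \<open>deg W x \<noteq> 1\<close> exempts exactly the edges that are isolated in the subgraph induced
  by \<open>W\<close>; adjacent vertices of different degree are distinguished by properness.
\<close>

definition avd :: "nat set \<Rightarrow> 'a set \<Rightarrow> ('a \<Rightarrow> 'a \<Rightarrow> nat) \<Rightarrow> bool" where
  "avd P W \<gamma> \<longleftrightarrow> proper_edge P W \<gamma> \<and>
     (\<forall>x\<in>W. \<forall>y\<in>N x \<inter> W. deg W x = deg W y \<and> deg W x \<noteq> 1 \<longrightarrow> cols \<gamma> W x \<noteq> cols \<gamma> W y)"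

definition add_star :: "'a \<Rightarrow> ('a \<Rightarrow> nat) \<Rightarrow> ('a \<Rightarrow> 'a \<Rightarrow> nat) \<Rightarrow> 'a \<Rightarrow> 'a \<Rightarrow> nat" where
  "add_star v h \<gamma> = (\<lambda>x y. if x = v then h y else if y = v then h x else \<gamma> x y)"

section \<open>Degrees and colour sets after adding a vertex with its star\<close>

lemma nbhd_insert_self: "N v \<inter> insert v W = N v \<inter> W"
  using irrefl by auto

lemma deg_insert_self: "deg (insert v W) v = deg W v"
  by (simp add: deg_def nbhd_insert_self)

lemma deg_insert:
  assumes "finite W" "v \<notin> W" 
  shows "deg (insert v W) x = (if v \<in> N x then Suc (deg W x) else deg W x)"
  using assms by (auto simp: deg_def Int_insert_right)

lemma cols_add_star_self:
  "cols (add_star v h \<gamma>) (insert v W) v = h ` (N v \<inter> W)"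
  by (auto simp: cols_def nbhd_insert_self add_star_def)

lemma cols_add_star:
  assumes "x \<in> W" "v \<notin> W"
  shows "cols (add_star v h \<gamma>) (insert v W) x
    = (if v \<in> N x then insert (h x) (cols \<gamma> W x) else cols \<gamma> W x)"
  using assms by (auto simp: cols_def add_star_def Int_insert_right image_iff)

lemma finite_cols: "finite W \<Longrightarrow> finite (cols \<gamma> W x)"
  by (simp add: cols_def)

lemma card_cols_le: "finite W \<Longrightarrow> card (cols \<gamma> W x) \<le> deg W x"
  unfolding cols_def deg_def by (rule card_image_le) simp

lemma card_cols: "proper_edge P W \<gamma> \<Longrightarrow> x \<in> W \<Longrightarrow> card (cols \<gamma> W x) = deg W x"
  unfolding cols_def deg_def proper_edge_def by (metis card_image)

lemma proper_edge_mono: "proper_edge P W \<gamma> \<Longrightarrow> P \<subseteq> Q \<Longrightarrow> proper_edge Q W \<gamma>"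
  unfolding proper_edge_def by blast

lemma proper_edge_add_star:
  assumes \<gamma>: "proper_edge P W \<gamma>" and v: "v \<notin> W"
    and h: "\<And>x. x \<in> N v \<inter> W \<Longrightarrow> h x \<in> P \<and> h x \<notin> cols \<gamma> W x" and inj: "inj_on h (N v \<inter> W)"
  shows "proper_edge P (insert v W) (add_star v h \<gamma>)"
  unfolding proper_edge_def
proof (intro conjI ballI)
  fix x y assume xy: "x \<in> insert v W" "y \<in> N x \<inter> insert v W"
  show "add_star v h \<gamma> x y = add_star v h \<gamma> y x"
    using xy \<gamma> v irrefl by (auto simp: add_star_def proper_edge_def)
  show "add_star v h \<gamma> x y \<in> P"
    using xy \<gamma> v irrefl h sym by (auto simp: add_star_def proper_edge_def)
next
  fix x assume x: "x \<in> insert v W"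
  show "inj_on (add_star v h \<gamma> x) (N x \<inter> insert v W)"
  proof (cases "x = v")
    case True
    then show ?thesis using inj by (auto simp: nbhd_insert_self add_star_def inj_on_def)
  next
    case False
    then have "x \<in> W" using x by auto
    have 1: "inj_on (add_star v h \<gamma> x) (N x \<inter> W)"
      using \<gamma> \<open>x \<in> W\<close> v False by (auto simp: proper_edge_def add_star_def inj_on_def)
    show ?thesis
    proof (cases "v \<in> N x")
      case True
      have "h x \<notin> cols \<gamma> W x" using h[of x] True sym \<open>x \<in> W\<close> by blast
      then show ?thesis using 1 True False v
        by (auto simp: Int_insert_right cols_def add_star_def image_iff)
    qed (use 1 in \<open>simp add: Int_insert_right\<close>)
  qed
qed

lemma deg_mono: "finite W \<Longrightarrow> W' \<subseteq> W \<Longrightarrow> deg W' x \<le> deg W x"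
  unfolding deg_def by (intro card_mono) auto

text \<open>Only \<open>v\<close> and its neighbours change their colour sets, so pairs avoiding all
  of these stay distinguished. \<open>nb\<close> treats a neighbour of \<open>v\<close> against
  another old vertex, \<open>centre\<close> treats \<open>v\<close> against its neighbours. The
  \<open>Suc\<close> in \<open>centre\<close> arises because degrees are taken in \<open>W\<close>:
  adding \<open>v\<close> raises the degree of \<open>x\<close> by one but not that of
  \<open>v\<close>.\<close>

lemma avd_add_star:
  assumes \<gamma>: "avd B W \<gamma>" and W: "finite W" "v \<notin> W"
    and h: "\<And>x. x \<in> N v \<inter> W \<Longrightarrow> h x \<in> B \<and> h x \<notin> cols \<gamma> W x" and inj: "inj_on h (N v \<inter> W)"
    and nb: "\<And>x z. x \<in> N v \<inter> W \<Longrightarrow> z \<in> N x \<inter> W \<Longrightarrow> deg (insert v W) x = deg (insert v W) z \<Longrightarrow>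
      insert (h x) (cols \<gamma> W x) \<noteq> (if z \<in> N v then insert (h z) (cols \<gamma> W z) else cols \<gamma> W z)"
    and centre: "\<And>x. x \<in> N v \<inter> W \<Longrightarrow> deg W v = Suc (deg W x) \<Longrightarrow> deg W v \<noteq> 1 \<Longrightarrow>
      h ` (N v \<inter> W) \<noteq> insert (h x) (cols \<gamma> W x)"
  shows "avd B (insert v W) (add_star v h \<gamma>)"
  unfolding avd_def
proof (intro conjI ballI impI)
  show "proper_edge B (insert v W) (add_star v h \<gamma>)"
    using \<gamma> W h inj by (intro proper_edge_add_star) (auto simp: avd_def)
next
  have vN: "v \<in> N x \<longleftrightarrow> x \<in> N v" for x using sym by blast
  have c: "cols (add_star v h \<gamma>) (insert v W) x
      = (if x \<in> N v then insert (h x) (cols \<gamma> W x) else cols \<gamma> W x)" if "x \<in> W" for x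
    using cols_add_star[OF that W(2)] vN by simp
  have d: "deg (insert v W) x = (if x \<in> N v then Suc (deg W x) else deg W x)" for x
    using deg_insert[OF W] vN by simp
  note cv = cols_add_star_self[of v h \<gamma> W] and dv = deg_insert_self[of v W]
  fix x y assume xy: "x \<in> insert v W" "y \<in> N x \<inter> insert v W"
    and dxy: "deg (insert v W) x = deg (insert v W) y \<and> deg (insert v W) x \<noteq> 1"
  consider "x = v" "y \<in> N v \<inter> W" | "y = v" "x \<in> N v \<inter> W"
    | "x \<in> W" "y \<in> W" "y \<in> N x" "x \<in> N v" | "x \<in> W" "y \<in> W" "x \<in> N y" "y \<in> N v"
    | "x \<in> W" "y \<in> W" "y \<in> N x" "x \<notin> N v" "y \<notin> N v"
    using xy irrefl sym by auto
  then show "cols (add_star v h \<gamma>) (insert v W) x \<noteq> cols (add_star v h \<gamma>) (insert v W) y"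
  proof cases
    case 1
    then show ?thesis using dxy centre[of y] cv dv c[of y] d[of y] by simp
  next
    case 2
    then show ?thesis using dxy centre[of x] cv dv c[of x] d[of x] by simp
  next
    case 3
    then show ?thesis using nb[of x y] dxy c[of x] c[of y] by simp
  next
    case 4
    then show ?thesis using nb[of y x] dxy c[of x] c[of y] by simp
  next
    case 5
    have "deg W x = deg W y \<and> deg W x \<noteq> 1" using dxy d[of x] d[of y] 5 by simp
    then have "cols \<gamma> W x \<noteq> cols \<gamma> W y" using \<gamma> 5 unfolding avd_def by blast
    then show ?thesis using 5 c[of x] c[of y] by simp
  qed
qed

text \<open>A leaf \<open>x\<close> of the new star has old degree at most \<open>D - 1\<close>, so
  its own colours and the sets of its neighbours exclude at most \<open>2 * (D - 1)\<close> colours.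
  From \<open>3 * D - 1\<close> colours this leaves \<open>D + 1\<close>, enough for the lists that
  \<open>star_extension\<close> asks for.\<close>

lemma ex_avd:
  assumes "finite W" "finite B" "D \<ge> 2" "3 * D - 1 \<le> card B" "\<And>x. x \<in> W \<Longrightarrow> deg W x \<le> D"
  shows "\<exists>\<gamma>. avd B W \<gamma>"
  using assms(1,5)
proof (induction W rule: finite_induct)
  case empty
  then show ?case by (auto simp: avd_def proper_edge_def)
next
  case (insert v W)
  have dW: "deg W x \<le> D" if "x \<in> W" for x
    using that by (meson deg_mono finite.insertI insert.hyps(1) insert.prems insertI2 le_trans subset_insertI)
  with insert.IH obtain \<gamma> where \<gamma>: "avd B W \<gamma>" by blast
  define S where "S = cols \<gamma> W"
  define X where "X = N v \<inter> W"
  have XW: "X \<subseteq> W" "finite X" using insert.hyps by (auto simp: X_def)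
  have vX: "v \<in> N x \<longleftrightarrow> x \<in> X" if "x \<in> W" for x using that sym by (auto simp: X_def)
  have fS: "finite (S x)" for x using insert.hyps by (simp add: S_def finite_cols)
  have cS: "card (S x) = deg W x" if "x \<in> W" for x
    using that \<gamma> card_cols[of B W \<gamma> x] by (simp add: S_def avd_def)
  have cX: "card X = deg W v" by (simp add: X_def deg_def)
  have cXD: "card X \<le> D" using insert.prems[of v] cX by (simp add: deg_insert_self)
  have dX: "deg W x \<le> D - 1" if "x \<in> X" for x
    using insert.prems[of x] that insert.hyps vX[of x] XW deg_insert[of W v x] by auto
  \<comment> \<open>Only leaves whose final degree equals that of \<open>v\<close> can clash with
    \<open>v\<close>. If \<open>v\<close> has a single neighbour, equal degrees mean an isolated
    edge of the new induced subgraph, which \<open>avd\<close> exempts.\<close>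
  define T where "T = (if card X = 1 then {} else {i \<in> X. card (S i) = card X - 1})"
  \<comment> \<open>A leaf is compared with an adjacent leaf only when both have been coloured,
    since the set of an uncoloured leaf will still change.\<close>
  define OK where "OK = (\<lambda>Z (h :: 'a \<Rightarrow> nat). inj_on h Z \<and> (\<forall>z\<in>Z. h z \<in> B \<and> h z \<notin> S z \<and>
     (\<forall>y\<in>N z \<inter> Z. insert (h z) (S z) \<noteq> insert (h y) (S y)) \<and>
     (\<forall>y\<in>N z \<inter> (W - X). insert (h z) (S z) \<noteq> S y)))"
  have "\<exists>h. OK X h \<and> (\<forall>i\<in>T. h ` (X - {i}) \<noteq> S i)"
  proof (rule star_extension[where OK = OK])
    show "finite X" "T \<subseteq> X" "card X = 1 \<Longrightarrow> T = {}" using XW by (auto simp: T_def)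
    show "finite (S i) \<and> card (S i) = card X - 1" if "i \<in> T" for i
      using that fS by (auto simp: T_def split: if_splits)
    show "inj_on h Z" if "OK Z h" for Z h using that by (simp add: OK_def)
    show "OK {} (\<lambda>_. 0)" by (simp add: OK_def)
    fix Z h x assume Z: "OK Z h" "Z \<subseteq> X" and x: "x \<in> X - Z"
    \<comment> \<open>The colour sets as they stand when just the leaves in \<open>Z\<close> have
      received their star colours.\<close>
    define S' where "S' = (\<lambda>y. if y \<in> Z then insert (h y) (S y) else S y)"
    have fZ: "finite Z" using Z XW finite_subset by blast
    let ?G = "{c \<in> B. c \<notin> S x \<and> insert c (S x) \<notin> S' ` (N x \<inter> W) \<and> c \<notin> h ` Z}"
    have "card B \<le> card ?G + (card (S x) + card (S' ` (N x \<inter> W)) + card (h ` Z))"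
      using fS fZ assms(2) insert.hyps by (intro card_free_colours) auto
    moreover have "card (S' ` (N x \<inter> W)) \<le> deg W x"
      unfolding deg_def using insert.hyps by (intro card_image_le) auto
    moreover have "card (h ` Z) \<le> card Z" using fZ by (rule card_image_le)
    moreover have "card X = card (X - Z) + card Z"
      using Z fZ XW by (metis card_Diff_subset card_mono le_add_diff_inverse2)
    \<comment> \<open>At least (3D-1) - 2(D-1) - |Z| = D + 1 - |Z| colours remain, and |X| is at
      most \<open>D\<close>.\<close>
    ultimately have "card (X - Z) + 1 \<le> card ?G"
      using cS[of x] dX[of x] x XW assms(3,4) cXD by auto
    then obtain L where L: "L \<subseteq> ?G" "card L = card (X - Z) + 1"
      by (meson obtain_subset_with_card_n)
    have "OK (insert x Z) (h(x := c))" if "c \<in> L" for c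
    proof -
      have c: "c \<in> B" "c \<notin> S x" "\<And>y. y \<in> N x \<inter> W \<Longrightarrow> insert c (S x) \<noteq> S' y" "c \<notin> h ` Z"
        using that L(1) by auto
      have 1: "insert c (S x) \<noteq> insert (h y) (S y)" if "y \<in> N x" "y \<in> Z" for y
        using c(3)[of y] that Z XW by (auto simp: S'_def)
      have 2: "insert c (S x) \<noteq> S y" if "y \<in> N x" "y \<in> W - X" for y
      proof -
        have "y \<notin> Z" using that Z(2) by blast
        then show ?thesis using c(3)[of y] that by (simp add: S'_def)
      qed
      have 3: "inj_on (h(x := c)) (insert x Z)"
        using Z c(4) x by (auto simp: OK_def inj_on_def)
      show ?thesis unfolding OK_def
      proof (intro conjI ballI)
        fix z y assume z: "z \<in> insert x Z"
        show "(h(x := c)) z \<in> B" "(h(x := c)) z \<notin> S z" using z Z c by (auto simp: OK_def)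
        show "insert ((h(x := c)) z) (S z) \<noteq> insert ((h(x := c)) y) (S y)" if y: "y \<in> N z \<inter> insert x Z"
        proof -
          consider "z = x" "y \<in> Z" "y \<noteq> x" | "y = x" "z \<in> Z" "z \<noteq> x" | "z \<noteq> x" "y \<noteq> x" "z \<in> Z" "y \<in> Z"
            using z y irrefl x by auto
          then show ?thesis
          proof cases
            case 1
            then show ?thesis using \<open>\<And>y. y \<in> N x \<Longrightarrow> y \<in> Z \<Longrightarrow> _\<close>[of y] y by auto
          next
            case 2
            then show ?thesis using 1[of z] y sym[of y z] by auto
          next
            case 3
            then show ?thesis using Z y by (auto simp: OK_def)
          qed
        qed
        show "insert ((h(x := c)) z) (S z) \<noteq> S y" if "y \<in> N z \<inter> (W - X)"
          using that z Z 2 by (auto simp: OK_def)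
      qed (rule 3)
    qed
    then show "\<exists>L. card L = card (X - Z) + 1 \<and> L \<inter> h ` Z = {} \<and> (\<forall>c\<in>L. OK (insert x Z) (h(x := c)))"
      using L by (intro exI[of _ L]) auto
  qed
  then obtain h where h: "OK X h" "\<And>i. i \<in> T \<Longrightarrow> h ` (X - {i}) \<noteq> S i" by blast
  have centre: "h ` X \<noteq> insert (h x) (S x)" if "x \<in> X" "card X = Suc (deg W x)" "card X \<noteq> 1" for x
  proof
    assume e: "h ` X = insert (h x) (S x)"
    \<comment> \<open>Deleting \<open>h x\<close> from both sides gives the equation that
      \<open>T\<close> excludes; injectivity of \<open>h\<close> and \<open>h x\<close> not lying in
      \<open>S x\<close> make the deletion exact.\<close>
    have "h ` (X - {x}) = h ` X - {h x}"
      using h(1) that by (auto simp: OK_def inj_on_def)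
    also have "\<dots> = S x" using e h(1) that by (auto simp: OK_def)
    finally have "x \<notin> T" using h(2) by blast
    moreover have "x \<in> T" using that cS[of x] XW by (auto simp: T_def)
    ultimately show False by blast
  qed
  have "avd B (insert v W) (add_star v h \<gamma>)"
  proof (rule avd_add_star[OF \<gamma> insert.hyps])
    show "inj_on h (N v \<inter> W)" using h(1) by (simp add: OK_def X_def)
    show "h x \<in> B \<and> h x \<notin> cols \<gamma> W x" if "x \<in> N v \<inter> W" for x
      using h(1) that by (simp add: OK_def X_def S_def)
    show "insert (h x) (cols \<gamma> W x) \<noteq> (if z \<in> N v then insert (h z) (cols \<gamma> W z) else cols \<gamma> W z)"
      if "x \<in> N v \<inter> W" "z \<in> N x \<inter> W" for x z
      using h(1) that by (auto simp: OK_def X_def S_def)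
    show "h ` (N v \<inter> W) \<noteq> insert (h x) (cols \<gamma> W x)"
      if "x \<in> N v \<inter> W" "deg W v = Suc (deg W x)" "deg W v \<noteq> 1" for x
      using centre[of x] that by (simp add: X_def S_def deg_def)
  qed
  then show ?case by blast
qed

text \<open>The edge to \<open>w\<close> is cheap: \<open>w\<close> has degree at least 3, so only
  its at most two neighbours in \<open>U\<close> can share its degree. The possible second edge at
  \<open>v\<close> then has to avoid at most \<open>2 * D - 1\<close> colours.\<close>

lemma ex_avd_2_degenerate:
  assumes "finite W" "finite B" "D \<ge> 3" "2 * D \<le> card B" "\<And>x. x \<in> W \<Longrightarrow> deg W x \<le> D"
    and "\<And>U. U \<subseteq> W \<Longrightarrow> U \<noteq> {} \<Longrightarrow> \<exists>x\<in>U. deg U x \<le> 2"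
  shows "\<exists>\<gamma>. avd B W \<gamma>"
  using assms(1,5,6)
proof (induction W rule: finite_psubset_induct)
  case (psubset W)
  define U where "U = {x \<in> W. 3 \<le> deg W x}"
  show ?case
  proof (cases "U = {}")
    case True
    have "deg W x \<le> 2" if "x \<in> W" for x using True that by (auto simp: U_def not_le)
    \<comment> \<open>For degrees at most 2, \<open>ex_avd\<close> asks for 5 colours, and
      \<open>2 * D\<close> is at least 6.\<close>
    then show ?thesis using ex_avd[of W B 2] psubset.hyps assms(2-4) by auto
  next
    case False
    have UW: "U \<subseteq> W" "finite U" using psubset.hyps by (auto simp: U_def)
    obtain w where w: "w \<in> U" "deg U w \<le> 2" using psubset.prems(2)[OF UW(1) False] by blast
    \<comment> \<open>\<open>w\<close> has at least three neighbours in \<open>W\<close> but at most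
      two in \<open>U\<close>, so some neighbour has degree at most 2.\<close>
    have "\<not> N w \<inter> W \<subseteq> N w \<inter> U"
    proof
      assume "N w \<inter> W \<subseteq> N w \<inter> U"
      then have "card (N w \<inter> W) \<le> card (N w \<inter> U)" using UW by (intro card_mono) auto
      then show False using w by (auto simp: deg_def U_def)
    qed
    then obtain v where v: "v \<in> N w" "v \<in> W" "v \<notin> U" by auto
    define W' where "W' = W - {v}"
    have W': "finite W'" "v \<notin> W'" "W = insert v W'" using psubset.hyps v by (auto simp: W'_def)
    have "\<exists>\<gamma>. avd B W' \<gamma>"
    proof (rule psubset.IH)
      show "W' \<subset> W" using v by (auto simp: W'_def)
      show "deg W' x \<le> D" if "x \<in> W'" for x
      proof -
        have "deg W' x \<le> deg W x" using psubset.hyps by (intro deg_mono) (auto simp: W'_def)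
        also have "\<dots> \<le> D" using that by (intro psubset.prems(1)) (simp add: W'_def)
        finally show ?thesis .
      qed
      show "\<exists>x\<in>U. deg U x \<le> 2" if "U \<subseteq> W'" "U \<noteq> {}" for U
      proof -
        have "U \<subseteq> W" using that(1) W'_def by blast
        then show ?thesis using psubset.prems(2) that(2) by blast
      qed
    qed
    then obtain \<gamma> where \<gamma>: "avd B W' \<gamma>" by blast
    define S where "S = cols \<gamma> W'"
    define X where "X = N v \<inter> W'"
    have fS: "finite (S x)" for x using W' by (simp add: S_def finite_cols)
    have cS: "card (S x) = deg W' x" if "x \<in> W'" for x
      using that \<gamma> card_cols[of B W' \<gamma> x] by (simp add: S_def avd_def)
    have dX: "deg W x = Suc (deg W' x)" if "x \<in> X" for x
    proof -
      have "v \<in> N x" using that sym by (simp add: X_def)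
      then show ?thesis using deg_insert[OF W'(1,2), of x] W'(3) by simp
    qed
    have dD: "Suc (deg W' x) \<le> D" if "x \<in> X" for x
      using dX[OF that] psubset.prems(1)[of x] that by (auto simp: X_def W'_def)
    have fX: "finite X" using W' by (simp add: X_def)
    have cX: "card X = deg W' v" "card X = deg W v" using W' by (simp_all add: X_def deg_def nbhd_insert_self)
    have "card X \<le> 2" using v cX by (auto simp: U_def)
    have "w \<noteq> v" "w \<in> W" using v w UW by auto
    then have wX: "w \<in> X" using sym[OF v(1)] by (simp add: X_def W'_def)
    have wW: "w \<in> W'" "2 \<le> deg W' w" using wX w(1) dX[OF wX] by (simp_all add: X_def U_def)
    have cF: "card (S ` (N w \<inter> U)) \<le> 2"
      using w(2) UW card_image_le[of "N w \<inter> U" S] by (auto simp: deg_def)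
    have zU: "z \<in> U" if "z \<in> W'" "deg W w = deg W z" for z
      using that w by (auto simp: U_def W'_def)
    show ?thesis
    proof (cases "X = {w}")
      case True
      have "\<exists>c\<in>B. c \<notin> S w \<and> insert c (S w) \<notin> S ` (N w \<inter> U) \<and> c \<notin> {}"
        using fS UW cF cS[OF wW(1)] dD[OF wX] assms(3,4) by (intro ex_free_colour) auto
      then obtain c where c: "c \<in> B" "c \<notin> S w" "insert c (S w) \<notin> S ` (N w \<inter> U)" by auto
      have "avd B (insert v W') (add_star v (\<lambda>_. c) \<gamma>)"
      proof (rule avd_add_star[OF \<gamma> W'(1,2)], fold X_def S_def)
        fix x z assume "x \<in> X" "z \<in> N x \<inter> W'" "deg (insert v W') x = deg (insert v W') z"
        then have "x = w" "z \<in> N w \<inter> U" "z \<notin> X" using True zU irrefl by (auto simp: W'(3)[symmetric])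
        then show "insert c (S x) \<noteq> (if z \<in> N v then insert c (S z) else S z)"
          using c(3) UW v by (auto simp: X_def W'_def)
      qed (use True c cX in auto)
      then show ?thesis using W'(3) by auto
    next
      case False
      have "card (X - {w}) = 1"
      proof -
        have "X - {w} \<noteq> {}" using False wX by auto
        then have "card (X - {w}) > 0" using fX by (simp add: card_gt_0_iff)
        then show ?thesis using \<open>card X \<le> 2\<close> wX fX by simp
      qed
      then obtain y where "X - {w} = {y}" by (auto simp: card_1_singleton_iff)
      then have X: "X = {w, y}" "y \<noteq> w" using wX by auto
      have y: "y \<in> X" "y \<in> W'" using X by (auto simp: X_def)
      \<comment> \<open>\<open>v\<close> will have degree 2, so it can clash with \<open>y\<close>
        only if \<open>y\<close> has old degree 1. Keeping the colour of \<open>vw\<close> out of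
        \<open>S y\<close> then separates the two.\<close>
      define R where "R = (if deg W' y = 1 then S y else {})"
      have R: "finite R" "card R \<le> 1" using fS cS[OF y(2)] by (auto simp: R_def)
      \<comment> \<open>At most (D-1) + 2 + 1 colours are excluded, fewer than 2D because
        \<open>D\<close> is at least 3.\<close>
      have "\<exists>c\<in>B. c \<notin> S w \<and> insert c (S w) \<notin> S ` (N w \<inter> U) \<and> c \<notin> R"
        using fS UW cF cS[OF wW(1)] dD[OF wX] assms(3,4) R by (intro ex_free_colour) auto
      then obtain c1 where c1: "c1 \<in> B" "c1 \<notin> S w" "insert c1 (S w) \<notin> S ` (N w \<inter> U)" "c1 \<notin> R" by auto
      define S' where "S' = S(w := insert c1 (S w))"
      have cF': "card (S' ` (N y \<inter> W')) \<le> deg W' y"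
        unfolding deg_def using W' by (intro card_image_le) auto
      \<comment> \<open>At most (D-1) + (D-1) + 1 colours are excluded. \<open>S'\<close> already
        counts the colour \<open>c1\<close> at \<open>w\<close>, in case \<open>w\<close> and
        \<open>y\<close> are adjacent.\<close>
      have "\<exists>c\<in>B. c \<notin> S y \<and> insert c (S y) \<notin> S' ` (N y \<inter> W') \<and> c \<notin> {c1}"
        using fS W' cF' cS[OF y(2)] dD[OF y(1)] assms(3,4) by (intro ex_free_colour) auto
      then obtain c2 where c2: "c2 \<in> B" "c2 \<notin> S y" "c2 \<noteq> c1"
        "\<And>z. z \<in> N y \<inter> W' \<Longrightarrow> insert c2 (S y) \<noteq> S' z" by auto
      define h where "h = (\<lambda>_. c2)(w := c1)"
      have hw: "h w = c1" "h y = c2" using X by (auto simp: h_def)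
      have "avd B (insert v W') (add_star v h \<gamma>)"
      proof (rule avd_add_star[OF \<gamma> W'(1,2)], fold X_def S_def)
        show "inj_on h X" using X hw c2 by auto
        show "h x \<in> B \<and> h x \<notin> S x" if "x \<in> X" for x using that X hw c1 c2 by auto
        fix x assume x: "x \<in> X"
        show "insert (h x) (S x) \<noteq> (if z \<in> N v then insert (h z) (S z) else S z)"
          if z: "z \<in> N x \<inter> W'" "deg (insert v W') x = deg (insert v W') z" for z
        proof -
          have zN: "z \<in> N v \<longleftrightarrow> z = w \<or> z = y" using z X by (auto simp: X_def)
          consider "x = w" "z = y" | "x = w" "z \<noteq> w" "z \<noteq> y" | "x = y" "z \<noteq> y" 
            using x z X irrefl by auto
          then show ?thesis
          proof cases
            case 1
            then have "w \<in> N y \<inter> W'" using z sym wW by auto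
            then show ?thesis using c2(4)[of w] 1 zN hw by (simp add: S'_def)
          next
            case 2
            then have "z \<in> U" using zU z by (simp add: W'(3)[symmetric])
            then have "insert c1 (S w) \<noteq> S z" using c1(3) 2(1) z(1) by blast
            then show ?thesis using 2 zN hw by simp
          next
            case 3
            then have "insert c2 (S y) \<noteq> S' z" using c2(4) z(1) by blast
            then show ?thesis using 3 zN hw by (simp add: S'_def split: if_splits)
          qed
        qed
        show "h ` X \<noteq> insert (h x) (S x)" if "deg W' v = Suc (deg W' x)" "deg W' v \<noteq> 1"
        proof -
          have "deg W' x = 1" using that cX X by simp
          then have "x = y" "c1 \<notin> S y" using x X wW c1(4) by (auto simp: R_def)
          then show ?thesis using hw X c2(3) by auto
        qed
      qed
      then show ?thesis using W'(3) by auto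
    qed
  qed
qed

text \<open>Greedy colouring: a vertex with at most \<open>m\<close> neighbours is coloured
  last.\<close>

lemma ex_vertex_colouring:
  assumes "finite W" "\<And>U. U \<subseteq> W \<Longrightarrow> U \<noteq> {} \<Longrightarrow> \<exists>x\<in>U. deg U x \<le> m"
  shows "\<exists>c :: 'a \<Rightarrow> nat. \<forall>x\<in>W. c x \<in> {1..m + 1} \<and> (\<forall>y\<in>N x \<inter> W. c x \<noteq> c y)"
  using assms
proof (induction W rule: finite_psubset_induct)
  case (psubset W)
  show ?case
  proof (cases "W = {}")
    case False
    then obtain v where v: "v \<in> W" "deg W v \<le> m" using psubset.prems by blast
    have "\<exists>c :: 'a \<Rightarrow> nat. \<forall>x\<in>W - {v}. c x \<in> {1..m + 1} \<and> (\<forall>y\<in>N x \<inter> (W - {v}). c x \<noteq> c y)"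
      using v psubset.prems by (intro psubset.IH) auto
    then obtain c :: "'a \<Rightarrow> nat" where c: "\<And>x. x \<in> W - {v} \<Longrightarrow> c x \<in> {1..m + 1}"
      "\<And>x y. x \<in> W - {v} \<Longrightarrow> y \<in> N x \<inter> (W - {v}) \<Longrightarrow> c x \<noteq> c y" by blast
    have "card (c ` (N v \<inter> W)) \<le> m"
      using v(2) psubset.hyps card_image_le[of "N v \<inter> W" c] by (auto simp: deg_def)
    then have "\<not> {1..m + 1} \<subseteq> c ` (N v \<inter> W)"
      using card_mono[of "c ` (N v \<inter> W)" "{1..m + 1}"] psubset.hyps by auto
    then obtain k where k: "k \<in> {1..m + 1}" "k \<notin> c ` (N v \<inter> W)" by blast
    have "(c(v := k)) x \<noteq> (c(v := k)) y" if xy: "x \<in> W" "y \<in> N x \<inter> W" for x y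
    proof -
      consider "x = v" "y \<noteq> v" | "y = v" "x \<noteq> v" | "x \<noteq> v" "y \<noteq> v" using xy irrefl[of v] by auto
      then show ?thesis
      proof cases
        case 1 then show ?thesis using k(2) xy by auto
      next
        case 2
        then have "x \<in> N v \<inter> W" using xy sym by auto
        then show ?thesis using 2 k(2) by auto
      next
        case 3 then show ?thesis using c(2)[of x y] xy by auto
      qed
    qed
    then show ?thesis using c(1) k(1) by (intro exI[of _ "c(v := k)"]) auto
  qed auto
qed

section \<open>Seven colours for maximum degree two\<close>

text \<open>
  \<open>A\<close> is the vertex palette, \<open>B\<close> the edge palette. An edge coloured from \<open>A\<close> may only join vertices of
  degree 2, so in the induction the last edge at a vertex of degree 1 always has a colour in \<open>B\<close>.
\<close>

definition mixed_colouring ::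
  "nat set \<Rightarrow> nat set \<Rightarrow> ('a \<Rightarrow> nat) \<Rightarrow> 'a set \<Rightarrow> ('a \<Rightarrow> 'a \<Rightarrow> nat) \<Rightarrow> bool" where
  "mixed_colouring A B c W \<gamma> \<longleftrightarrow> proper_edge (A \<union> B) W \<gamma> \<and>
     (\<forall>x\<in>W. \<forall>y\<in>N x \<inter> W. \<gamma> x y \<noteq> c x \<and> (\<gamma> x y \<notin> B \<longrightarrow> deg W x = 2) \<and>
       (deg W x \<noteq> 1 \<or> deg W y \<noteq> 1 \<longrightarrow> cols \<gamma> W x \<inter> B \<noteq> cols \<gamma> W y \<inter> B))"

text \<open>Counterpart of \<open>avd_add_star\<close> without a hypothesis of equal degrees in
  \<open>nb\<close>: an edge coloured from \<open>A\<close> is invisible in \<open>B\<close>, so the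
  number of \<open>B\<close>-colours at a vertex no longer determines its degree.\<close>

lemma mixed_colouring_add_star:
  assumes \<gamma>: "mixed_colouring A B c W \<gamma>" and W: "finite W" "v \<notin> W"
    and deg2: "\<And>x. x \<in> insert v W \<Longrightarrow> deg (insert v W) x \<le> 2"
    and h: "\<And>x. x \<in> N v \<inter> W \<Longrightarrow> h x \<in> A \<union> B \<and> h x \<notin> cols \<gamma> W x \<and> h x \<noteq> c x \<and> h x \<noteq> c v"
    and hB: "\<And>x. x \<in> N v \<inter> W \<Longrightarrow> h x \<notin> B \<Longrightarrow> deg W v = 2 \<and> deg W x = 1"
    and inj: "inj_on h (N v \<inter> W)"
    and nb: "\<And>x z. x \<in> N v \<inter> W \<Longrightarrow> z \<in> N x \<inter> W \<Longrightarrow>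
      insert (h x) (cols \<gamma> W x) \<inter> B \<noteq> (if z \<in> N v then insert (h z) (cols \<gamma> W z) else cols \<gamma> W z) \<inter> B"
    and centre: "\<And>x. x \<in> N v \<inter> W \<Longrightarrow> deg W v \<noteq> 1 \<or> deg W x \<noteq> 0 \<Longrightarrow>
      h ` (N v \<inter> W) \<inter> B \<noteq> insert (h x) (cols \<gamma> W x) \<inter> B"
  shows "mixed_colouring A B c (insert v W) (add_star v h \<gamma>)"
  unfolding mixed_colouring_def
proof (intro conjI ballI impI)
  show "proper_edge (A \<union> B) (insert v W) (add_star v h \<gamma>)"
    using \<gamma> W h inj by (intro proper_edge_add_star) (auto simp: mixed_colouring_def)
next
  have vN: "v \<in> N x \<longleftrightarrow> x \<in> N v" for x using sym by blast
  have c: "cols (add_star v h \<gamma>) (insert v W) x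
      = (if x \<in> N v then insert (h x) (cols \<gamma> W x) else cols \<gamma> W x)" if "x \<in> W" for x
    using cols_add_star[OF that W(2)] vN by simp
  have d: "deg (insert v W) x = (if x \<in> N v then Suc (deg W x) else deg W x)" for x
    using deg_insert[OF W] vN by simp
  note cv = cols_add_star_self[of v h \<gamma> W] and dv = deg_insert_self[of v W]
  have old: "\<gamma> x y \<noteq> c x" "\<gamma> x y \<notin> B \<Longrightarrow> deg W x = 2"
    "deg W x \<noteq> 1 \<or> deg W y \<noteq> 1 \<Longrightarrow> cols \<gamma> W x \<inter> B \<noteq> cols \<gamma> W y \<inter> B"
    if "x \<in> W" "y \<in> W" "y \<in> N x" for x y
    using \<gamma> that unfolding mixed_colouring_def by blast+
  fix x y assume xy: "x \<in> insert v W" "y \<in> N x \<inter> insert v W"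
  consider (centre1) "x = v" "y \<in> N v \<inter> W" "y \<noteq> v" | (centre2) "y = v" "x \<in> N v \<inter> W" "x \<noteq> v"
    | (far) "x \<in> W" "y \<in> W" "y \<in> N x" "x \<noteq> v" "y \<noteq> v"
    using xy irrefl sym W(2) by auto
  note cs = this
  show "add_star v h \<gamma> x y \<noteq> c x"
    using cs
  proof cases
    case far
    then show ?thesis using old(1) by (simp add: add_star_def)
  qed (use h in \<open>simp_all add: add_star_def\<close>)
  show "deg (insert v W) x = 2" if "add_star v h \<gamma> x y \<notin> B"
    using cs
  proof cases
    case far
    then have "deg W x = 2" using old(2) that by (simp add: add_star_def)
    \<comment> \<open>An endpoint of an old \<open>A\<close>-edge already has degree 2, so it cannot
      also be adjacent to \<open>v\<close>.\<close>
    then show ?thesis using d[of x] deg2[of x] far by (simp split: if_splits)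
  qed (use hB that d dv in \<open>auto simp: add_star_def\<close>)
  assume dxy: "deg (insert v W) x \<noteq> 1 \<or> deg (insert v W) y \<noteq> 1"
  show "cols (add_star v h \<gamma>) (insert v W) x \<inter> B \<noteq> cols (add_star v h \<gamma>) (insert v W) y \<inter> B"
    using cs
  proof cases
    case centre1
    then show ?thesis using dxy centre[of y] cv dv c[of y] d[of y] by simp
  next
    case centre2
    have "h ` (N v \<inter> W) \<inter> B \<noteq> insert (h x) (cols \<gamma> W x) \<inter> B"
      using centre2 dxy dv d[of x] by (intro centre) auto
    then show ?thesis using centre2 cv c[of x] by simp
  next
    case far
    consider "x \<in> N v" | "y \<in> N v" | "x \<notin> N v" "y \<notin> N v" by blast
    then show ?thesis
    proof cases
      case 1
      then show ?thesis using nb[of x y] far c[of x] c[of y] by simp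
    next
      case 2
      have "x \<in> N y" using sym far by blast
      then show ?thesis using 2 nb[of y x] far c[of x] c[of y] by simp
    next
      case 3
      then have "cols \<gamma> W x \<inter> B \<noteq> cols \<gamma> W y \<inter> B" using old(3) far dxy d[of x] d[of y] by simp
      then show ?thesis using 3 far c[of x] c[of y] by simp
    qed
  qed
qed

lemma ex_colour_outside: "finite R \<Longrightarrow> card R < card B \<Longrightarrow> \<exists>k\<in>B. k \<notin> R"
  by (meson card_mono linorder_not_less subsetI)

text \<open>
  The edge \<open>vw\<close> gets a colour \<open>t\<close> from the vertex palette, so that \<open>w\<close> keeps its colour set within \<open>B\<close>.
\<close>

lemma mixed_colouring_extend_degree_2:
  assumes \<gamma>: "mixed_colouring A B c W \<gamma>" and W: "finite W" "v \<notin> W"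
    and deg2: "\<And>x. x \<in> insert v W \<Longrightarrow> deg (insert v W) x \<le> 2"
    and AB: "card A \<ge> 3" "card B \<ge> 4" "A \<inter> B = {}" and c: "\<And>x. x \<in> insert v W \<Longrightarrow> c x \<in> A"
    and X: "N v \<inter> W = {u, w}" "u \<noteq> w"
    and u: "N u \<inter> W = {u'}" and w: "N w \<inter> W = {w'}"
    and w': "cols \<gamma> W w' \<inter> B \<noteq> {\<gamma> w w'}"
  shows "\<exists>\<gamma>. mixed_colouring A B c (insert v W) \<gamma>"
proof -
  have uw: "u \<in> W" "w \<in> W" "u' \<in> W" "w' \<in> W" "u' \<in> N u" "w' \<in> N w" "w \<in> N v" "u \<in> N v"
    using X u w by auto
  have d1: "deg W u = 1" "deg W w = 1" using u w by (simp_all add: deg_def)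
  have dv: "deg W v = 2" using X by (simp add: deg_def)
  have cu: "cols \<gamma> W u = {\<gamma> u u'}" "cols \<gamma> W w = {\<gamma> w w'}" by (simp_all add: cols_def u w)
  have inB: "\<gamma> u u' \<in> B" "\<gamma> w w' \<in> B"
    using \<gamma> uw d1 unfolding mixed_colouring_def by fastforce+
  have sy: "\<gamma> u u' = \<gamma> u' u" "\<gamma> w w' = \<gamma> w' w"
    using \<gamma> uw unfolding mixed_colouring_def proper_edge_def by blast+
  have au: "\<gamma> u u' \<in> cols \<gamma> W u'" using uw sym sy unfolding cols_def by blast
  \<comment> \<open>If \<open>u\<close> and \<open>w\<close> were adjacent, \<open>w'\<close> would
    be \<open>u\<close>, whose only colour is that of \<open>uw\<close>, contrary to the assumption
    on \<open>w'\<close>.\<close>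
  have "u' \<noteq> w" "w' \<noteq> u"
  proof -
    show "w' \<noteq> u"
    proof
      assume "w' = u"
      then have "w \<in> N u \<inter> W" using uw sym by blast
      then have "u' = w" using u by simp
      have "\<gamma> u u' = \<gamma> w w'" using sy(1) unfolding \<open>w' = u\<close> \<open>u' = w\<close> .
      then have "cols \<gamma> W w' \<inter> B = {\<gamma> w w'}" using cu(1) inB(1) \<open>w' = u\<close> by simp
      then show False using w' by blast
    qed
    moreover have "u \<in> N w \<inter> W" if "u' = w" using uw that sym[of u' u] by simp
    ultimately show "u' \<noteq> w" using w by auto
  qed
  moreover have "u' \<noteq> u" "w' \<noteq> w" using uw irrefl by auto
  ultimately have "u' \<notin> N v \<inter> W" "w' \<notin> N v \<inter> W" unfolding X by simp_all
  then have nX: "u' \<notin> N v" "w' \<notin> N v" using uw(3,4) by simp_all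
  have "card (cols \<gamma> W u') \<le> 2"
    using card_cols_le[OF W(1), of \<gamma> u'] deg_mono[of "insert v W" W u'] deg2[of u'] W uw by fastforce
  then have cR: "card (insert (\<gamma> w w') (cols \<gamma> W u')) \<le> 3"
    using card_insert_le_m1 [of 3 "cols \<gamma> W u'" "\<gamma> w w'"] by simp
  \<comment> \<open>\<open>k\<close> colours \<open>vu\<close> and separates \<open>u\<close> from
    \<open>u'\<close>. In \<open>B\<close> the vertex \<open>v\<close> then sees only
    \<open>k\<close>, \<open>w\<close> only \<gamma> w w', and \<open>u\<close> both
    \<open>k\<close> and another colour.\<close>
  obtain k where k: "k \<in> B" "k \<noteq> \<gamma> w w'" "k \<notin> cols \<gamma> W u'"
    using ex_colour_outside[of "insert (\<gamma> w w') (cols \<gamma> W u')" B] cR AB(2) W finite_cols by auto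
  have "card {c v, c w} \<le> 2" by (simp add: card_insert_if)
  then obtain t where t: "t \<in> A" "t \<noteq> c v" "t \<noteq> c w"
    using ex_colour_outside[of "{c v, c w}" A] AB(1) by auto
  define h where "h = (\<lambda>_. k)(w := t)"
  have hw: "h w = t" "h u = k" using X(2) by (auto simp: h_def)
  have kt: "k \<notin> A" "t \<notin> B" using AB k t by auto
  have "mixed_colouring A B c (insert v W) (add_star v h \<gamma>)"
  proof (rule mixed_colouring_add_star[OF \<gamma> W deg2], unfold X)
    fix x assume x: "x \<in> {u, w}"
    show "h x \<in> A \<union> B \<and> h x \<notin> cols \<gamma> W x \<and> h x \<noteq> c x \<and> h x \<noteq> c v"
      using x hw k t kt cu inB au c uw by auto
    show "deg W v = 2 \<and> deg W x = 1" using x d1 dv by auto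
    show "h ` {u, w} \<inter> B \<noteq> insert (h x) (cols \<gamma> W x) \<inter> B"
      using x hw k t kt cu inB au by auto
    fix z assume "z \<in> N x \<inter> W"
    then have "x = u \<and> z = u' \<or> x = w \<and> z = w'" using x u w by blast
    then show "insert (h x) (cols \<gamma> W x) \<inter> B \<noteq> (if z \<in> N v then insert (h z) (cols \<gamma> W z) else cols \<gamma> W z) \<inter> B"
      using nX hw k kt w' cu inB by auto
  qed (use hw X kt k in \<open>auto simp: inj_on_def\<close>)
  then show ?thesis by blast
qed

text \<open>A vertex of degree at most 1 is removed if there is one, and its edge takes a colour of
  \<open>B\<close>. Otherwise all degrees are 2, and removing any vertex leaves its two neighbours
  with degree 1, hence with remaining edges coloured from \<open>B\<close>.\<close>

lemma ex_mixed_colouring: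
  assumes "finite W" "\<And>x. x \<in> W \<Longrightarrow> deg W x \<le> 2"
    and AB: "card A \<ge> 3" "card B \<ge> 4" "A \<inter> B = {}" and c: "\<And>x. x \<in> W \<Longrightarrow> c x \<in> A"
  shows "\<exists>\<gamma>. mixed_colouring A B c W \<gamma>"
  using assms(1,2,6)
proof (induction W rule: finite_psubset_induct)
  case (psubset V)
  show ?case
  proof (cases "V = {}")
    case True
    then show ?thesis by (simp add: mixed_colouring_def proper_edge_def)
  next
    case False
    obtain v where v: "v \<in> V" "deg V v \<le> 1 \<or> (\<forall>x\<in>V. deg V x = 2)"
    proof (cases "\<exists>v\<in>V. deg V v \<le> 1")
      case no: False
      have "deg V x = 2" if "x \<in> V" for x using psubset.prems(1)[OF that] no that by fastforce
      then show ?thesis using False that by blast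
    qed (use that in blast)
    define W where "W = V - {v}"
    have W: "finite W" "v \<notin> W" and V: "V = insert v W" using psubset.hyps v by (auto simp: W_def)
    have d: "deg V x = (if v \<in> N x then Suc (deg W x) else deg W x)" for x
      unfolding V by (rule deg_insert[OF W])
    have deg2: "deg (insert v W) x \<le> 2" if "x \<in> insert v W" for x
      using psubset.prems(1)[of x] that V by simp
    have dv: "deg V v = deg W v" unfolding V by (rule deg_insert_self)
    have "\<exists>\<gamma>. mixed_colouring A B c W \<gamma>"
    proof (rule psubset.IH)
      show "W \<subset> V" using V W by blast
      show "deg W x \<le> 2" if "x \<in> W" for x
        using psubset.prems(1)[of x] d[of x] that V by (simp split: if_splits)
      show "c x \<in> A" if "x \<in> W" for x using psubset.prems(2) that V by blast
    qed
    then obtain \<gamma> where \<gamma>: "mixed_colouring A B c W \<gamma>" by blast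
    have fS: "finite (cols \<gamma> W x)" for x using W by (simp add: finite_cols)
    have cA: "c x \<in> A" if "x \<in> insert v W" for x using psubset.prems(2) that V by blast
    have notA: "k \<noteq> c x" if "k \<in> B" "x \<in> insert v W" for k x using that cA AB(3) by blast
    have single: "\<exists>y. N x \<inter> W = {y} \<and> y \<in> N x \<and> y \<in> W \<and> \<gamma> x y \<in> B \<and> \<gamma> x y \<in> cols \<gamma> W y
        \<and> cols \<gamma> W x = {\<gamma> x y}" if x: "x \<in> W" "deg W x = 1" for x
    proof -
      obtain y where y: "N x \<inter> W = {y}" using x(2) unfolding deg_def by (meson card_1_singletonE)
      then have yx: "y \<in> N x" "y \<in> W" by auto
      have "\<gamma> x y \<in> B" "\<gamma> x y = \<gamma> y x"
        using \<gamma> x yx unfolding mixed_colouring_def proper_edge_def by fastforce+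
      moreover have "\<gamma> y x \<in> cols \<gamma> W y" using x(1) sym[OF yx(1)] unfolding cols_def by blast
      ultimately show ?thesis using y yx by (auto simp: cols_def)
    qed
    have dX: "deg W x \<le> 1" "v \<in> N x" if "x \<in> N v \<inter> W" for x
    proof -
      show "v \<in> N x" using that sym by blast
      then show "deg W x \<le> 1" using d[of x] psubset.prems(1)[of x] that V by simp
    qed
    show ?thesis
    proof (cases "deg V v \<le> 1")
      case True
      \<comment> \<open>For the only possible neighbour \<open>x\<close> of \<open>v\<close>, these
        are the colours at \<open>x\<close> and at the other neighbour of \<open>x\<close>.\<close>
      define R where "R = (\<Union>x\<in>N v \<inter> W. cols \<gamma> W x \<union> (\<Union>y\<in>N x \<inter> W. cols \<gamma> W y))"
      have "finite R" using W fS by (simp add: R_def)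
      moreover have "card R \<le> 3"
      proof -
        consider "N v \<inter> W = {}" | x where "N v \<inter> W = {x}"
        proof -
          have "card (N v \<inter> W) = 0 \<or> card (N v \<inter> W) = 1" using True dv by (auto simp: deg_def)
          then show ?thesis using that W(1) by (metis card_0_eq card_1_singletonE finite_Int)
        qed
        then show ?thesis
        proof cases
          case (2 x)
          then have x: "x \<in> W" "deg W x \<le> 1" using dX[of x] by auto
          show ?thesis
          proof (cases "deg W x = 1")
            case d1: True
            obtain y where y: "N x \<inter> W = {y}" "y \<in> W" "cols \<gamma> W x = {\<gamma> x y}" "\<gamma> x y \<in> cols \<gamma> W y"
              using single[OF x(1) d1] by blast
            have "R = cols \<gamma> W y" using 2 y by (auto simp: R_def)
            moreover have "card (cols \<gamma> W y) \<le> deg W y" using W by (intro card_cols_le)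
            moreover have "deg W y \<le> deg V y" using d[of y] by simp
            ultimately show ?thesis using psubset.prems(1)[of y] y(2) V by simp
          next
            case False
            then have "deg W x = 0" using x(2) by simp
            then have "N x \<inter> W = {}" using W by (simp add: deg_def)
            then show ?thesis using 2 by (simp add: R_def cols_def)
          qed
        qed (simp add: R_def)
      qed
      ultimately obtain k where k: "k \<in> B" "k \<notin> R" using ex_colour_outside[of R B] AB(2) by auto
      have "mixed_colouring A B c (insert v W) (add_star v (\<lambda>_. k) \<gamma>)"
      proof (rule mixed_colouring_add_star[OF \<gamma> W deg2])
        fix x assume x: "x \<in> N v \<inter> W"
        then have kx: "k \<notin> cols \<gamma> W x" "\<And>y. y \<in> N x \<inter> W \<Longrightarrow> k \<notin> cols \<gamma> W y" using k(2) by (auto simp: R_def)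
        have one: "card (N v \<inter> W) \<le> 1" using True dv by (simp add: deg_def)
        then have X: "N v \<inter> W = {x}" using x W card_seteq[of "N v \<inter> W" "{x}"] by auto
        show "k \<in> A \<union> B \<and> k \<notin> cols \<gamma> W x \<and> k \<noteq> c x \<and> k \<noteq> c v" using k kx notA x by auto
        show "insert k (cols \<gamma> W x) \<inter> B \<noteq> (if z \<in> N v then insert k (cols \<gamma> W z) else cols \<gamma> W z) \<inter> B"
          if "z \<in> N x \<inter> W" for z
        proof -
          have "z \<noteq> x" using that irrefl by auto
          then have "z \<notin> N v \<inter> W" unfolding X by simp
          then have "z \<notin> N v" using that by simp
          then show ?thesis using kx that k(1) by auto
        qed
        show "(\<lambda>_. k) ` (N v \<inter> W) \<inter> B \<noteq> insert k (cols \<gamma> W x) \<inter> B" if "deg W v \<noteq> 1 \<or> deg W x \<noteq> 0"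
        proof -
          have "deg W v = 1" using X by (simp add: deg_def)
          \<comment> \<open>The old edge at \<open>x\<close> has a colour in \<open>B\<close>, so
            \<open>x\<close> sees one more colour of \<open>B\<close> than \<open>v\<close>
            does.\<close>
          then have "deg W x = 1" using that dX[OF x] by simp
          then obtain y where "\<gamma> x y \<in> B" "cols \<gamma> W x = {\<gamma> x y}" using single x by blast
          then show ?thesis using X kx(1) by auto
        qed
        show "deg W v = 2 \<and> deg W x = 1" if "k \<notin> B" using that k by blast
      next
        show "inj_on (\<lambda>_. k) (N v \<inter> W)"
          using True dv W by (simp add: deg_def inj_on_def card_le_Suc0_iff_eq)
      qed
      then show ?thesis unfolding V by blast
    next
      case False
      then have all2: "deg V x = 2" if "x \<in> V" for x using v(2) that by blast
      then have "card (N v \<inter> W) = 2" using v(1) dv by (simp add: deg_def)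
      then obtain u w where X: "N v \<inter> W = {u, w}" "u \<noteq> w" by (meson card_2_iff)
      then have uw: "u \<in> W" "w \<in> W" "u \<in> N v" "w \<in> N v" by auto
      have d1: "deg W u = 1" "deg W w = 1"
        using d[of u] d[of w] dX(2)[of u] dX(2)[of w] all2[of u] all2[of w] X V by auto
      obtain u' where u': "N u \<inter> W = {u'}" "u' \<in> N u" "u' \<in> W" "\<gamma> u u' \<in> B" "\<gamma> u u' \<in> cols \<gamma> W u'"
        "cols \<gamma> W u = {\<gamma> u u'}" using single[OF uw(1) d1(1)] by blast
      obtain w' where w': "N w \<inter> W = {w'}" "w' \<in> N w" "w' \<in> W" "\<gamma> w w' \<in> B" "\<gamma> w w' \<in> cols \<gamma> W w'"
        "cols \<gamma> W w = {\<gamma> w w'}" using single[OF uw(2) d1(2)] by blast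
      consider "cols \<gamma> W w' \<inter> B \<noteq> {\<gamma> w w'}" | "cols \<gamma> W u' \<inter> B \<noteq> {\<gamma> u u'}"
        | (pure) "cols \<gamma> W w' \<inter> B = {\<gamma> w w'}" "cols \<gamma> W u' \<inter> B = {\<gamma> u u'}" by blast
      then show ?thesis
      proof cases
        case 1
        then show ?thesis unfolding V
          using mixed_colouring_extend_degree_2[OF \<gamma> W deg2 AB cA X u'(1) w'(1)] by blast
      next
        case 2
        have "N v \<inter> W = {w, u}" "w \<noteq> u" using X by auto
        then show ?thesis unfolding V
          using mixed_colouring_extend_degree_2[OF \<gamma> W deg2 AB cA _ _ w'(1) u'(1)] 2 by blast
      next
        \<comment> \<open>\<open>u'\<close> and \<open>w'\<close> see in \<open>B\<close> only
          \<open>a\<close> and \<open>b\<close> respectively. Two further colours of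
          \<open>B\<close>, distinct from both and from each other, then serve for \<open>vu\<close>
          and \<open>vw\<close>, even if \<open>u\<close> and \<open>w\<close> are adjacent.\<close>
        case pure
        define a where "a = \<gamma> u u'"
        define b where "b = \<gamma> w w'"
        have ab: "a \<in> B" "b \<in> B" "cols \<gamma> W u = {a}" "cols \<gamma> W w = {b}"
          "cols \<gamma> W u' \<inter> B = {a}" "cols \<gamma> W w' \<inter> B = {b}"
          using u' w' pure by (simp_all add: a_def b_def)
        have "card {a, b} < card B" using AB(2) by (simp add: card_insert_if)
        then obtain k where k: "k \<in> B" "k \<noteq> a" "k \<noteq> b"
          using ex_colour_outside[of "{a, b}" B] by auto
        have "card {a, b, k} < card B" using AB(2) by (simp add: card_insert_if)
        then obtain l where l: "l \<in> B" "l \<noteq> a" "l \<noteq> b" "l \<noteq> k"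
          using ex_colour_outside[of "{a, b, k}" B] by auto
        define h where "h = (\<lambda>_. k)(w := l)"
        have hw: "h w = l" "h u = k" using X(2) by (auto simp: h_def)
        have "mixed_colouring A B c (insert v W) (add_star v h \<gamma>)"
        proof (rule mixed_colouring_add_star[OF \<gamma> W deg2], unfold X)
          fix x assume x: "x \<in> {u, w}"
          have "h x \<in> B" "x \<in> W" using x hw k l uw by auto
          then show "h x \<in> A \<union> B \<and> h x \<notin> cols \<gamma> W x \<and> h x \<noteq> c x \<and> h x \<noteq> c v"
            using x hw k l ab notA[of "h x" x] notA[of "h x" v] by auto
          show "deg W v = 2 \<and> deg W x = 1" if "h x \<notin> B" using that \<open>h x \<in> B\<close> by blast
          show "h ` {u, w} \<inter> B \<noteq> insert (h x) (cols \<gamma> W x) \<inter> B"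
            using x hw k l ab by auto
          fix z assume "z \<in> N x \<inter> W"
          then have xz: "x = u \<and> z = u' \<or> x = w \<and> z = w'" using x u'(1) w'(1) by blast
          have nz: "h z = (if z = w then l else k)" by (simp add: h_def)
          have zX: "z \<in> N v \<longleftrightarrow> z = u \<or> z = w" using X(1) xz u'(3) w'(3) by blast
          have "u' \<noteq> u" "w' \<noteq> w" using u'(2) w'(2) irrefl by auto
          then have "h x \<noteq> h z" if "z \<in> N v" using that xz nz zX hw l(4) by auto
          moreover have "h x \<in> B" "h x \<notin> cols \<gamma> W z \<inter> B" using xz hw k l ab by auto
          ultimately show "insert (h x) (cols \<gamma> W x) \<inter> B
              \<noteq> (if z \<in> N v then insert (h z) (cols \<gamma> W z) else cols \<gamma> W z) \<inter> B"
            by auto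
        qed (use hw X l in \<open>auto simp: inj_on_def\<close>)
        then show ?thesis unfolding V by blast
      qed
    qed
  qed
qed

end

section \<open>Total colourings\<close>

text \<open>By symmetry the colour does not depend on which ordering of the endpoints the choice
  operator picks.\<close>

lemma Inr_colouring_of_symmetric:
  assumes "\<And>x y. {x, y} \<in> E \<Longrightarrow> \<gamma> x y = \<gamma> y x"
  shows "\<exists>g. \<forall>x y. {x, y} \<in> E \<longrightarrow> g {x, y} = \<gamma> x y"
proof -
  define g where "g = (\<lambda>e. SOME k. \<exists>x y. e = {x, y} \<and> k = \<gamma> x y)"
  have "g {x, y} = \<gamma> x y" if "{x, y} \<in> E" for x y
  proof -
    have "\<exists>x' y'. {x, y} = {x', y'} \<and> g {x, y} = \<gamma> x' y'"
      unfolding g_def by (rule someI_ex) blast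
    then show ?thesis using assms[OF that] by (auto simp: doubleton_eq_iff)
  qed
  then show ?thesis by blast
qed

section \<open>Passing from finite simple graphs to neighbourhood functions\<close>

lemma finite_simple_graph_edge:
  assumes "finite_simple_graph G" "{x, y} \<in> edges G"
  shows "x \<in> verts G" "y \<in> verts G" "x \<noteq> y"
  using assms unfolding finite_simple_graph_def by (auto dest!: bspec)

lemma adjacency_nbhd:
  assumes "finite_simple_graph G"
  shows "adjacency (nbhd G)"
proof
  show "x \<in> nbhd G y" if "y \<in> nbhd G x" for x y
    using that by (simp add: nbhd_def insert_commute)
  show "x \<notin> nbhd G x" for x
    using finite_simple_graph_edge(3)[OF assms, of x x] by (auto simp: nbhd_def)
qed

lemma nbhd_subset_verts: "finite_simple_graph G \<Longrightarrow> nbhd G x \<subseteq> verts G"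
  using finite_simple_graph_edge(2) by (fastforce simp: nbhd_def)

text \<open>Vertex colours stay below \<open>a + 1\<close>, so the part of a colour set in
  \<open>{a + 1..a + b}\<close> comes from edges alone and can distinguish neighbours. Edges may
  still use the whole range, which allows borrowed vertex colours.\<close>

lemma ex_D1_VSDTC:
  assumes G: "finite_simple_graph G"
    and c: "\<And>x. x \<in> verts G \<Longrightarrow> c x \<in> {1..a}" "\<And>x y. {x, y} \<in> edges G \<Longrightarrow> c x \<noteq> c y"
    and \<gamma>: "adjacency.proper_edge (nbhd G) {1..a + b} (verts G) \<gamma>"
    and inc: "\<And>x y. {x, y} \<in> edges G \<Longrightarrow> \<gamma> x y \<noteq> c x"
    and dist: "\<And>x y. {x, y} \<in> edges G \<Longrightarrow>
      adjacency.cols (nbhd G) \<gamma> (verts G) x \<inter> {a + 1..a + b} \<noteq>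
      adjacency.cols (nbhd G) \<gamma> (verts G) y \<inter> {a + 1..a + b}"
  shows "\<exists>f. D1_VSDTC G (a + b) f"
proof -
  interpret adjacency "nbhd G" using G by (rule adjacency_nbhd)
  note ed = finite_simple_graph_edge[OF G]
  have nb: "nbhd G x \<inter> verts G = nbhd G x" for x using nbhd_subset_verts[OF G] by blast
  have \<gamma>': "\<gamma> x y = \<gamma> y x" "\<gamma> x y \<in> {1..a + b}" if "{x, y} \<in> edges G" for x y
    using \<gamma> that ed(1,2)[OF that] unfolding proper_edge_def by (auto simp: nbhd_def)
  have inj: "\<gamma> x y \<noteq> \<gamma> x z" if "{x, y} \<in> edges G" "{x, z} \<in> edges G" "y \<noteq> z" for x y z
  proof -
    have "inj_on (\<gamma> x) (nbhd G x)" using \<gamma> ed(1)[OF that(1)] unfolding proper_edge_def nb by blast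
    then show ?thesis using that unfolding inj_on_def nbhd_def by blast
  qed
  obtain g where g: "\<And>x y. {x, y} \<in> edges G \<Longrightarrow> g {x, y} = \<gamma> x y"
    using Inr_colouring_of_symmetric[of "edges G" \<gamma>] \<gamma>'(1) by blast
  define f where "f = case_sum c g"
  have pair: "\<exists>y. e = {x, y}" if "e \<in> edges G" "x \<in> e" for e x
  proof -
    have "card e = 2" using G that by (simp add: finite_simple_graph_def)
    then show ?thesis using that(2) by (auto simp: card_2_iff)
  qed
  have ex: "\<exists>x y. e = {x, y}" if "e \<in> edges G" for e
  proof -
    have "card e = 2" using G that by (simp add: finite_simple_graph_def)
    then show ?thesis unfolding card_2_iff by blast
  qed
  have "proper_total_coloring G (a + b) f"
    unfolding proper_total_coloring_def
  proof (intro conjI allI impI ballI)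
    show "f \<in> verts G <+> edges G \<rightarrow> {1..a + b}"
    proof
      fix z assume "z \<in> verts G <+> edges G"
      then show "f z \<in> {1..a + b}"
      proof
        fix x assume "x \<in> verts G" "z = Inl x"
        then show ?thesis using c(1)[of x] by (simp add: f_def)
      next
        fix e assume e: "e \<in> edges G" "z = Inr e"
        then obtain x y where "e = {x, y}" using ex by blast
        then show ?thesis using e g[of x y] \<gamma>'(2)[of x y] by (simp add: f_def)
      qed
    qed
    show "f (Inl u) \<noteq> f (Inl v)" if "{u, v} \<in> edges G" for u v
      using c(2) that by (simp add: f_def)
    show "f (Inr e) \<noteq> f (Inr e')" if e: "e \<in> edges G" "e' \<in> edges G" "e \<noteq> e' \<and> e \<inter> e' \<noteq> {}" for e e'
    proof -
      obtain x where "x \<in> e" "x \<in> e'" using e(3) by blast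
      then obtain y z where "e = {x, y}" "e' = {x, z}" using pair e(1,2) by meson
      then show ?thesis using e inj[of x y z] g[of x y] g[of x z] by (auto simp: f_def)
    qed
    show "f (Inl v) \<noteq> f (Inr e)" if e: "e \<in> edges G" "v \<in> e" for e v
    proof -
      obtain y where "e = {v, y}" using pair e by blast
      then show ?thesis using e inc[of v y] g[of v y] by (auto simp: f_def)
    qed
  qed
  moreover have "color_set G f u \<noteq> color_set G f v" if "{u, v} \<in> edges G" for u v
  proof -
    have "color_set G f x \<inter> {a + 1..a + b} = cols \<gamma> (verts G) x \<inter> {a + 1..a + b}" if "x \<in> verts G" for x
    proof -
      have 1: "f ` (Inl ` closed_nbhd G x) \<subseteq> {1..a}"
        using that c(1) nbhd_subset_verts[OF G, of x] by (auto simp: f_def closed_nbhd_def)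
      have 2: "f ` (Inr ` {{x, v} | v. v \<in> nbhd G x}) = cols \<gamma> (verts G) x"
      proof -
        have "f ` (Inr ` {{x, v} | v. v \<in> nbhd G x}) = (\<lambda>v. g {x, v}) ` nbhd G x"
          unfolding setcompr_eq_image image_image by (simp add: f_def)
        also have "\<dots> = \<gamma> x ` nbhd G x"
          by (rule image_cong) (simp_all add: g nbhd_def)
        finally show ?thesis unfolding cols_def nb .
      qed
      have "color_set G f x = f ` (Inl ` closed_nbhd G x) \<union> cols \<gamma> (verts G) x"
        unfolding color_set_def total_nbhd_def Plus_def image_Un 2 by (rule refl)
      moreover have "{1..a} \<inter> {a + 1..a + b} = {}" by auto
      then have "f ` (Inl ` closed_nbhd G x) \<inter> {a + 1..a + b} = {}" using 1 by (meson disjoint_iff subsetD)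
      ultimately show ?thesis by (simp only: Int_Un_distrib2 Un_empty_left)
    qed
    then show ?thesis using dist[OF that] ed(1,2)[OF that] by metis
  qed
  ultimately show ?thesis unfolding D1_VSDTC_def by blast
qed

lemma chi_1vsdt_le: "D1_VSDTC G \<kappa> f \<Longrightarrow> chi_1vsdt G \<le> enat \<kappa>"
  unfolding chi_1vsdt_def by (intro Inf_lower) blast

text \<open>Degeneracy is applied to the subgraph induced by \<open>U\<close>, whose minimum degree
  is attained at a vertex.\<close>

lemma degenerated_ex_small_degree:
  assumes G: "finite_simple_graph G" "degenerated k G" and U: "U \<subseteq> verts G" "U \<noteq> {}"
  shows "\<exists>x\<in>U. card (nbhd G x \<inter> U) \<le> k"
proof -
  define H where "H = (U, {e \<in> edges G. e \<subseteq> U})"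
  have fU: "finite U" using G U finite_subset unfolding finite_simple_graph_def by blast
  have "subgraph H G"
    using G(1) U fU by (auto simp: subgraph_def H_def finite_simple_graph_def)
  then have "min_degree H \<le> k" using G(2) U by (simp add: degenerated_def H_def)
  moreover have "min_degree H \<in> degree H ` U"
    unfolding min_degree_def using U fU by (simp add: H_def)
  moreover have "degree H x = card (nbhd G x \<inter> U)" if "x \<in> U" for x
  proof -
    have "nbhd H x = nbhd G x \<inter> U" using that by (auto simp: nbhd_def H_def)
    then show ?thesis by (simp add: degree_def)
  qed
  ultimately show ?thesis by auto
qed

text \<open>The set \<open>{u, v}\<close> is closed under adjacency, so it is the whole component of
  \<open>u\<close>.\<close>

lemma isolated_edgeI:
  assumes e: "{u, v} \<in> edges G" and u: "u \<in> verts G" "nbhd G u = {v}" and v: "nbhd G v = {u}"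
  shows "isolated_edge G {u, v}"
proof -
  have step: "y \<in> {u, v}" if "(x, y) \<in> adj_rel G" "x \<in> {u, v}" for x y
    using that u v by (auto simp: adj_rel_def nbhd_def)
  have "y \<in> {u, v}" if "(u, y) \<in> (adj_rel G)\<^sup>*" for y
    using that by (induction rule: rtrancl_induct) (use step in blast)+
  moreover have "(u, v) \<in> (adj_rel G)\<^sup>*" using e by (auto simp: adj_rel_def)
  ultimately have "{u, v} = {y. (u, y) \<in> (adj_rel G)\<^sup>*}" by blast
  then show ?thesis using e u(1) unfolding isolated_edge_def components_def by blast
qed

theorem corollary1p10:
  fixes G :: "'a graph" and k :: nat
  assumes "k \<ge> 2"
    and "finite_simple_graph G"
    and "degenerated k G"
    and "edges G \<noteq> {}"
    and "\<not> (\<exists>e. isolated_edge G e)"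
  shows "chi_1vsdt G \<le> enat (min (k * max_degree G + 3) (4 * max_degree G))"
proof -
  note G = assms(2)
  interpret adjacency "nbhd G" using G by (rule adjacency_nbhd)
  define V where "V = verts G"
  define D where "D = max_degree G"
  note ed = finite_simple_graph_edge[OF G, folded V_def]
  have fV: "finite V" using G by (simp add: V_def finite_simple_graph_def)
  have nb: "nbhd G x \<inter> V = nbhd G x" for x using nbhd_subset_verts[OF G] by (auto simp: V_def)
  have deg: "deg V x = degree G x" for x by (simp add: deg_def degree_def nb)
  have D: "deg V x \<le> D" if "x \<in> V" for x
    using that fV unfolding D_def max_degree_def deg by (intro Max_ge) (auto simp: V_def)
  \<comment> \<open>This discharges the exemptions for degree 1 in \<open>avd\<close> and
    \<open>mixed_colouring\<close>.\<close>
  have not_both: "deg V x \<noteq> 1 \<or> deg V y \<noteq> 1" if e: "{x, y} \<in> edges G" for x y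
  proof (rule ccontr)
    assume "\<not> ?thesis"
    then have "card (nbhd G x) = 1" "card (nbhd G y) = 1" by (auto simp: deg degree_def)
    moreover have "y \<in> nbhd G x" "x \<in> nbhd G y" using e by (simp_all add: nbhd_def insert_commute)
    ultimately have "nbhd G x = {y}" "nbhd G y = {x}" by (metis card_1_singletonE singletonD)+
    then show False using isolated_edgeI[OF e] ed(1)[OF e] assms(5) by (simp add: V_def)
  qed
  have D2: "D \<ge> 2"
  proof -
    obtain e0 where e0: "e0 \<in> edges G" using assms(4) by blast
    then have "card e0 = 2" using G by (simp add: finite_simple_graph_def)
    then obtain x y where "e0 = {x, y}" unfolding card_2_iff by blast
    then have e: "{x, y} \<in> edges G" using e0 by simp
    have "y \<in> nbhd G x \<inter> V" "x \<in> nbhd G y \<inter> V"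
      using e ed[OF e] by (simp_all add: nbhd_def insert_commute)
    then have "deg V x > 0" "deg V y > 0" using fV by (auto simp: deg_def card_gt_0_iff)
    then show ?thesis using not_both[OF e] D[OF ed(1)[OF e]] D[OF ed(2)[OF e]] by linarith
  qed
  \<comment> \<open>Vertices use the first \<open>m + 1\<close> colours, edges the next
    \<open>b\<close>.\<close>
  have via_avd: "chi_1vsdt G \<le> enat (m + 1 + b)"
    if small: "\<And>U. U \<subseteq> V \<Longrightarrow> U \<noteq> {} \<Longrightarrow> \<exists>x\<in>U. deg U x \<le> m"
      and avd: "\<exists>\<gamma>. avd {m + 2..m + 1 + b} V \<gamma>" for m b
  proof -
    obtain c :: "'a \<Rightarrow> nat" where c: "\<And>x. x \<in> V \<Longrightarrow> c x \<in> {1..m + 1}" "\<And>x y. x \<in> V \<Longrightarrow> y \<in> nbhd G x \<inter> V \<Longrightarrow> c x \<noteq> c y"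
      using ex_vertex_colouring[OF fV small] by blast
    obtain \<gamma> where \<gamma>: "avd {m + 2..m + 1 + b} V \<gamma>" using avd by blast
    then have p: "proper_edge {m + 2..m + 1 + b} V \<gamma>" by (simp add: avd_def)
    have val: "\<gamma> x y \<in> {m + 2..m + 1 + b}" if "{x, y} \<in> edges G" for x y
      using p that ed[OF that] unfolding proper_edge_def nb by (simp add: nbhd_def)
    have sub: "cols \<gamma> V x \<inter> {m + 1 + 1..m + 1 + b} = cols \<gamma> V x" if "x \<in> V" for x
    proof -
      have "\<gamma> x y \<in> {m + 1 + 1..m + 1 + b}" if "y \<in> nbhd G x" for y
        using val[of x y] that by (simp add: nbhd_def)
      then show ?thesis unfolding cols_def nb by blast
    qed
    have "\<exists>f. D1_VSDTC G (m + 1 + b) f"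
    proof (rule ex_D1_VSDTC[OF G, folded V_def])
      show "c x \<in> {1..m + 1}" if "x \<in> V" for x using that by (rule c)
      show "proper_edge {1..m + 1 + b} V \<gamma>" using p by (rule proper_edge_mono) auto
      fix x y assume e: "{x, y} \<in> edges G"
      have xy: "x \<in> V" "y \<in> V" "y \<in> nbhd G x \<inter> V" using e ed[OF e] by (auto simp: nbhd_def)
      show "c x \<noteq> c y" using c(2) xy by blast
      show "\<gamma> x y \<noteq> c x" using val[OF e] c(1)[OF xy(1)] by auto
      have "cols \<gamma> V x \<noteq> cols \<gamma> V y"
      proof (cases "deg V x = deg V y")
        case True
        then show ?thesis using \<gamma> xy not_both[OF e] unfolding avd_def by auto
      next
        case False
        then show ?thesis using card_cols[OF p xy(1)] card_cols[OF p xy(2)] by auto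
      qed
      then show "cols \<gamma> V x \<inter> {m + 1 + 1..m + 1 + b} \<noteq> cols \<gamma> V y \<inter> {m + 1 + 1..m + 1 + b}"
        unfolding sub[OF xy(1)] sub[OF xy(2)] .
    qed
    then show ?thesis using chi_1vsdt_le by blast
  qed
  have kdeg: "\<exists>x\<in>U. deg U x \<le> k" if "U \<subseteq> V" "U \<noteq> {}" for U
    using degenerated_ex_small_degree[OF G assms(3)] that unfolding deg_def V_def by blast
  have Ddeg: "\<exists>x\<in>U. deg U x \<le> D" if "U \<subseteq> V" "U \<noteq> {}" for U
    using that D deg_mono[OF fV that(1)] by (meson equals0I order_trans subsetD)
  have avdD: "\<exists>\<gamma>. avd {m + 2..m + 1 + (3 * D - 1)} V \<gamma>" for m
    using fV D2 D by (intro ex_avd) auto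
  \<comment> \<open>(D + 1) + (3D - 1) = 4D, with \<open>D\<close> as the greedy bound on
    degrees.\<close>
  have four: "chi_1vsdt G \<le> enat (4 * D)"
    using via_avd[OF Ddeg avdD] D2 by simp
  moreover have "chi_1vsdt G \<le> enat (k * D + 3)"
  proof -
    consider "k = 2" "D = 2" | "k = 2" "D \<ge> 3" | "k = 3" | "k \<ge> 4" using assms(1) D2 by linarith
    then show ?thesis
    proof cases
      case 1
      obtain c :: "'a \<Rightarrow> nat" where c: "\<And>x. x \<in> V \<Longrightarrow> c x \<in> {1..3}" "\<And>x y. x \<in> V \<Longrightarrow> y \<in> nbhd G x \<inter> V \<Longrightarrow> c x \<noteq> c y"
        using ex_vertex_colouring[OF fV kdeg] 1 by auto
      \<comment> \<open>Three vertex colours and four edge colours give 7 = 2 * 2 + 3.\<close>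
      have "\<exists>\<gamma>. mixed_colouring {1..3} {4..7} c V \<gamma>"
        using fV D 1 c(1) by (intro ex_mixed_colouring) auto
      then obtain \<gamma> where \<gamma>: "mixed_colouring {1..3} {4..7} c V \<gamma>" by blast
      have "\<exists>f. D1_VSDTC G (3 + 4) f"
      proof (rule ex_D1_VSDTC[OF G, folded V_def])
        show "c x \<in> {1..3}" if "x \<in> V" for x using that by (rule c)
        have "proper_edge ({1..3} \<union> {4..7}) V \<gamma>" using \<gamma> by (simp add: mixed_colouring_def)
        then show "proper_edge {1..3 + 4} V \<gamma>" by (rule proper_edge_mono) auto
        fix x y assume e: "{x, y} \<in> edges G"
        have xy: "x \<in> V" "y \<in> nbhd G x \<inter> V" using e ed[OF e] by (auto simp: nbhd_def)
        show "c x \<noteq> c y" using c(2) xy by blast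
        show "\<gamma> x y \<noteq> c x" using \<gamma> xy unfolding mixed_colouring_def by blast
        have "cols \<gamma> V x \<inter> {4..7} \<noteq> cols \<gamma> V y \<inter> {4..7}"
          using \<gamma> xy not_both[OF e] unfolding mixed_colouring_def by blast
        then show "cols \<gamma> V x \<inter> {3 + 1..3 + 4} \<noteq> cols \<gamma> V y \<inter> {3 + 1..3 + 4}" by simp
      qed
      then show ?thesis using chi_1vsdt_le 1 by fastforce
    next
      case 2
      have "\<exists>\<gamma>. avd {2 + 2..2 + 1 + 2 * D} V \<gamma>"
        using fV 2 D kdeg by (intro ex_avd_2_degenerate[of V _ D]) auto
      then have "chi_1vsdt G \<le> enat (2 + 1 + 2 * D)" by (rule via_avd[rotated]) (use kdeg 2 in auto)
      also have "2 + 1 + 2 * D = k * D + 3" using 2 by simp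
      finally show ?thesis .
    next
      case 3
      \<comment> \<open>Here 3 is the greedy bound: 4 + (3D - 1) = 3D + 3.\<close>
      then show ?thesis using via_avd[of 3 "3 * D - 1", OF _ avdD] kdeg D2 by (simp add: add.commute)
    next
      case 4
      then have "4 * D \<le> k * D + 3" by (simp add: trans_le_add1)
      then show ?thesis using four by (meson enat_ord_simps(1) order_trans)
    qed
  qed
  ultimately show ?thesis by (simp add: D_def min_def)
qed

end
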